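(* Let $p\in\{5,7\}$. There exist nonzero constants $c_5\in\mathbb{Z}/5\mathbb{Z}$ and $c_7\in\mathbb{Z}/7\mathbb{Z}$ such that for all $r,s\in\mathbb{P}^1(\mathbb{Q})$, $$\alpha_p\overline{\varphi}^+_\Delta(\{r\}-\{s\})\equiv c_p\big(\phi_p(\{r\})-\phi_p(\{s\})\big)\pmod p,$$ where $\phi_p:\mathbb{P}^1(\mathbb{Q})\to\mathbb{Z}/p\mathbb{Z}$ is the $\Gamma_1(p)$-invariant function given by: for $p=5$, $\phi_5(r)=2$ if $r\in\Gamma_1(5)\{\infty\}$, $\phi_5(r)=3$ if $r\in\Gamma_1(5)\{2/5\}$, and $\phi_5(r)=0$ otherwise; for $p=7$, $\phi_7(r)=2$ if $r\in\Gamma_1(7)\{\infty\}$, $\phi_7(r)=1$ if $r\in \Gamma_1(7)\{2/7\}$, $\phi_7(r)=4$ if $r\in\Gamma_1(7)\{3/7\}$, and $\phi_7(r)=0$ otherwise.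
   Context: $\Delta=\sum_{n\ge1}\tau(n)q^n=q\prod_{n\ge1}(1-q^n)^{24}$. For a commutative ring $R$, $V_k(R)$ is the $R$-module of homogeneous degree-$k$ polynomials in $X,Y$, with right $\mathrm{GL}_2$-action $(P|_\gamma)(X,Y)=P(dX-cY,-bX+aY)$ for $\gamma=\begin{pmatrix}a&b\\c&d\end{pmatrix}$; $\mathrm{Div}^0$ is the group of degree-zero divisors on $\mathbb{P}^1(\mathbb{Q})$. $\varphi^+_\Delta\in\mathrm{Hom}_{\mathrm{SL}_2(\mathbb{Z})}(\mathrm{Div}^0,V_{10}(\mathbb{C}))$ is the sign-$+1$ (plus) part of the modular symbol $\{r\}-\{s\}\mapsto 2\pi i\int_s^r\Delta(z)(zX+Y)^{10}\,dz$ (integral along the geodesic in the upper half-plane), divided by its cohomological period at $p$ in the sense of Pollack–Weston, so that $\varphi^+_\Delta$ takes values in $V_{10}(\mathbb{Z}_{(p)})$ and not all its values lie in $pV_{10}(\mathbb{Z}_{(p)})$. $\overline{\varphi}^+_\Delta$ is its reduction modulo $p$, and $\alpha_p\overline{\varphi}^+_\Delta(D)=\overline{\varphi}^+_\Delta(D)(0,1)\in\mathbb{Z}/p\mathbb{Z}$ (evaluation at $(X,Y)=(0,1)$). The functions $\phi_5,\phi_7$ are the reductions modulo $p$ of the weight-$0$ boundary symbols attached to the Eisenstein series $E_{2,\omega_5^2,\mathbbm 1}$ and $E_{2,\omega_7^4,\mathbbm 1}$ respectively ($\omega_p$ the Teichmüller character), evaluated at the constant polynomial $1$. *)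

theory Defs
  imports "HOL-Analysis.Analysis" "HOL-Number_Theory.Cong"
begin

datatype cusp = Fin rat | Inf

definition Delta :: "complex \<Rightarrow> complex" where
  "Delta z = (let q = exp (2 * complex_of_real pi * \<i> * z)
              in q * (\<Prod>n. (1 - q ^ Suc n) ^ 24))"

definition up_integral :: "(complex \<Rightarrow> complex) \<Rightarrow> rat \<Rightarrow> complex" where
  "up_integral f a = integral {0<..} (\<lambda>t::real. f (of_rat a + \<i> * complex_of_real t) * \<i>)"

text \<open>For lo < hi: integral from hi to lo along the semicircular geodesic
  c + rho e^(i theta), theta from 0 to pi, c = (lo+hi)/2, rho = (hi-lo)/2.\<close>
definition semi_integral :: "(complex \<Rightarrow> complex) \<Rightarrow> rat \<Rightarrow> rat \<Rightarrow> complex" where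
  "semi_integral f lo hi =
     (let c = of_rat ((lo + hi) / 2); \<rho> = of_rat ((hi - lo) / 2)
      in integral {0<..<pi} (\<lambda>\<theta>::real.
            f (c + \<rho> * exp (\<i> * complex_of_real \<theta>)) * (\<i> * \<rho> * exp (\<i> * complex_of_real \<theta>))))"

fun geodesic_integral :: "(complex \<Rightarrow> complex) \<Rightarrow> cusp \<Rightarrow> cusp \<Rightarrow> complex" where
  "geodesic_integral f Inf Inf = 0"
| "geodesic_integral f (Fin a) Inf = up_integral f a"
| "geodesic_integral f Inf (Fin b) = - up_integral f b"
| "geodesic_integral f (Fin a) (Fin b) =
     (if a = b then 0 else if b < a then semi_integral f b a else - semi_integral f a b)"

text \<open>Elements of V_10(R) are represented by their coefficient functions:
  P = sum_{j \<le> 10} P j * X^j * Y^(10-j).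
  msym j r s is the X^j Y^(10-j) coefficient of
  {r}-{s} \<mapsto> 2 pi i int_s^r Delta(z) (zX+Y)^10 dz.\<close>
definition msym :: "nat \<Rightarrow> cusp \<Rightarrow> cusp \<Rightarrow> complex" where
  "msym j r s = 2 * complex_of_real pi * \<i> * of_nat (10 choose j)
                * geodesic_integral (\<lambda>z. Delta z * z ^ j) s r"

text \<open>The involution iota = diag(-1,1): acts on P^1(Q) by r \<mapsto> -r, and on V_10
  by (P|iota)(X,Y) = P(X,-Y).\<close>
fun cusp_neg :: "cusp \<Rightarrow> cusp" where
  "cusp_neg Inf = Inf"
| "cusp_neg (Fin a) = Fin (- a)"

text \<open>Plus part: phi^+ = (phi + phi|iota)/2, (phi|iota)(D) = phi(iota D)|iota.\<close>
definition msym_plus :: "nat \<Rightarrow> cusp \<Rightarrow> cusp \<Rightarrow> complex" where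
  "msym_plus j r s = (msym j r s + (-1) ^ (10 - j) * msym j (cusp_neg r) (cusp_neg s)) / 2"

definition Zloc :: "nat \<Rightarrow> complex set" where
  "Zloc p = {of_rat q | q. \<not> int p dvd snd (quotient_of q)}"

text \<open>Omega is a cohomological period at p (Pollack--Weston): phi^+/Omega has all values in
  V_10(Z_(p)) and not all values in p V_10(Z_(p)).  (Div^0 is generated by {r}-{s}.)\<close>
definition coh_period :: "nat \<Rightarrow> complex \<Rightarrow> bool" where
  "coh_period p \<Omega> \<longleftrightarrow> \<Omega> \<noteq> 0 \<and>
     (\<forall>r s. \<forall>j\<le>10. msym_plus j r s / \<Omega> \<in> Zloc p) \<and>
     (\<exists>r s. \<exists>j\<le>10. msym_plus j r s / (\<Omega> * of_nat p) \<notin> Zloc p)"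

definition Gamma1 :: "nat \<Rightarrow> int \<Rightarrow> int \<Rightarrow> int \<Rightarrow> int \<Rightarrow> bool" where
  "Gamma1 N a b c d \<longleftrightarrow> a * d - b * c = 1 \<and> [c = 0] (mod int N)
      \<and> [a = 1] (mod int N) \<and> [d = 1] (mod int N)"

fun moebius :: "int \<Rightarrow> int \<Rightarrow> int \<Rightarrow> int \<Rightarrow> cusp \<Rightarrow> cusp" where
  "moebius a b c d Inf = (if c = 0 then Inf else Fin (of_int a / of_int c))"
| "moebius a b c d (Fin x) =
     (if of_int c * x + of_int d = 0 then Inf
      else Fin ((of_int a * x + of_int b) / (of_int c * x + of_int d)))"

definition Gamma1_orbit :: "nat \<Rightarrow> cusp \<Rightarrow> cusp set" where
  "Gamma1_orbit N x = {moebius a b c d x | a b c d. Gamma1 N a b c d}"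

text \<open>The functions phi_5, phi_7 with values in Z/pZ (represented by integers).\<close>
definition phi5 :: "cusp \<Rightarrow> int" where
  "phi5 r = (if r \<in> Gamma1_orbit 5 Inf then 2
             else if r \<in> Gamma1_orbit 5 (Fin (2/5)) then 3 else 0)"

definition phi7 :: "cusp \<Rightarrow> int" where
  "phi7 r = (if r \<in> Gamma1_orbit 7 Inf then 2
             else if r \<in> Gamma1_orbit 7 (Fin (2/7)) then 1
             else if r \<in> Gamma1_orbit 7 (Fin (3/7)) then 4 else 0)"

definition phi_p :: "nat \<Rightarrow> cusp \<Rightarrow> int" where
  "phi_p p = (if p = 5 then phi5 else phi7)"

end

theory Submission
  imports Defs "HOL-Complex_Analysis.Complex_Analysis"
begin

text \<open>
  The product defining \<open>\<Delta>\<close> is modular: with \<open>\<theta>(z, t)\<close> a product formula for Jacobi's theta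
  function, \<open>exp (- \<pi> i z\<^sup>2 / t) \<theta>(z / t, - 1 / t) / \<theta>(z, t)\<close> is elliptic without poles, hence a
  constant \<open>c\<close> by Liouville's theorem. Its values at the three half periods give \<open>c\<^sup>3\<close> and its limit
  at \<open>0\<close> gives \<open>c\<close> in terms of \<open>\<Delta>\<close>, whence \<open>\<Delta>(- 1 / t) = t\<^sup>1\<^sup>2 \<Delta>(t)\<close>. The maximum principle applied to
  \<open>T\<^sub>2 \<Delta> / \<Delta>\<close> shows \<open>T\<^sub>2 \<Delta> = - 24 \<Delta>\<close>.

  Primitives of \<open>\<Delta>(z) z\<^sup>j\<close> have limits at all cusps, so the geodesic integrals form an equivariant
  additive symbol. The relations of \<open>SL\<^sub>2(\<int>)\<close> and the Hecke relation determine the even period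
  polynomial up to a scalar: it is proportional to \<open>36 (X\<^sup>1\<^sup>0 - Y\<^sup>1\<^sup>0) - 691 X\<^sup>2 Y\<^sup>2 (X\<^sup>2 - Y\<^sup>2)\<^sup>3\<close>.
  By Manin's continued fraction trick all values of the symbol are integral multiples of that scalar,
  which is therefore a \<open>p\<close>-unit multiple of the period, and the claim reduces to evaluating this
  polynomial at pairs of residues modulo 5 and 7.
\<close>

section \<open>Infinite products\<close>

text \<open>Three points shape the argument. In the inversion formula, the half periods express
  \<open>c ^ 3\<close> as an exponential with a fourth root of unity in front. Its fourth power
  removes that root and turns the squares in \<open>c\<close> into 24th powers, so it is Delta
  itself that transforms without a multiplier. The relations of SL_2(Z) alone cannot determine the
  period polynomial: X^10 - Y^10, the coboundary part, satisfies them too. The even solutions form a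
  plane, and the Hecke eigenvalue selects a line in it. The value at (0, 1) of the symbol on a
  translate of the base path is, up to the scalar, the period polynomial at the bottom row (c, d) of
  the matrix. Modulo 5 and 7 Fermat's theorem makes this vanish whenever c and d are both units.
  Hence only cusps with denominator divisible by p are seen, and the reduced symbol becomes a
  boundary symbol. The denominator 36 is harmless because it is prime to 5 and 7.\<close>

definition qp :: "complex \<Rightarrow> complex \<Rightarrow> complex" where
  "qp a q = (\<Prod>n. 1 - a * q ^ n)"

lemma convergent_prod_qp:
  fixes a q :: complex
  assumes "norm q < 1"
  shows "convergent_prod (\<lambda>n. 1 - a * q ^ n)"
proof -
  have "summable (\<lambda>n. norm a * norm q ^ n)"
    using assms by (intro summable_mult summable_geometric) auto
  moreover have "norm (1 - a * q ^ n - 1) = norm a * norm q ^ n" for n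
    by (simp add: norm_mult norm_power)
  ultimately have "abs_convergent_prod (\<lambda>n. 1 - a * q ^ n)"
    by (intro summable_imp_abs_convergent_prod) (simp only:)
  then show ?thesis by (rule abs_convergent_prod_imp_convergent_prod)
qed

lemma qp_LIMSEQ:
  assumes "norm q < 1"
  shows "(\<lambda>N. \<Prod>n<N. 1 - a * q ^ n) \<longlonglongrightarrow> qp a q"
  unfolding qp_def
  using convergent_prod_has_prod[OF convergent_prod_qp[OF assms]]
  by (rule has_prod_imp_tendsto')

lemma qp_Suc:
  assumes "norm q < 1"
  shows "qp a q = (1 - a) * qp (a * q) q"
proof (rule LIMSEQ_unique)
  show "(\<lambda>N. \<Prod>n<Suc N. 1 - a * q ^ n) \<longlonglongrightarrow> qp a q"
    using qp_LIMSEQ[OF assms] by (rule LIMSEQ_Suc)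
  have "(\<Prod>n<Suc N. 1 - a * q ^ n) = (1 - a) * (\<Prod>n<N. 1 - (a * q) * q ^ n)" for N
    by (subst prod.lessThan_Suc_shift) (simp add: mult.assoc)
  then show "(\<lambda>N. \<Prod>n<Suc N. 1 - a * q ^ n) \<longlonglongrightarrow> (1 - a) * qp (a * q) q"
    using tendsto_mult_left[OF qp_LIMSEQ[OF assms]] by simp
qed

lemma qp_nonzero:
  assumes "norm q < 1" "\<And>n. a * q ^ n \<noteq> 1"
  shows "qp a q \<noteq> 0"
  unfolding qp_def using assms by (intro prodinf_nonzero convergent_prod_qp) auto

lemma qp_self_nonzero:
  assumes "norm q < 1" shows "qp q q \<noteq> 0"
proof (rule qp_nonzero[OF assms])
  fix n
  have "norm q * norm q ^ n \<le> norm q * 1"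
    using assms by (intro mult_left_mono power_le_one) auto
  then have "norm (q * q ^ n) < 1" using assms by (simp add: norm_mult norm_power)
  then show "q * q ^ n \<noteq> 1" by auto
qed

text \<open>Base and coefficient both vary with z, so one statement gives holomorphy of the theta
  function in z at fixed q and of Delta through q itself. On a compact set the supremum of |g| is
  attained, hence lies below 1, and a geometric series majorises the factors.\<close>

lemma qp_uniform_limit:
  assumes K: "compact K" "continuous_on K f" "continuous_on K g" "\<And>z. z \<in> K \<Longrightarrow> norm (g z) < 1"
  shows "uniform_limit K (\<lambda>N z. \<Prod>n<N. 1 - f z * g z ^ n) (\<lambda>z. qp (f z) (g z)) sequentially"
proof (cases "K = {}")
  case False
  have "compact (f ` K)" using K by (intro compact_continuous_image)
  then obtain M where M: "\<And>z. z \<in> K \<Longrightarrow> norm (f z) \<le> M"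
    using compact_imp_bounded[of "f ` K"] unfolding bounded_iff by auto
  obtain z0 where z0: "z0 \<in> K" "\<And>z. z \<in> K \<Longrightarrow> norm (g z) \<le> norm (g z0)"
    using continuous_attains_sup[OF K(1) False, of "\<lambda>z. norm (g z)"] K by (auto intro: continuous_on_norm)
  define r where "r = norm (g z0)"
  have r: "r < 1" "0 \<le> r" "\<And>z. z \<in> K \<Longrightarrow> norm (g z) \<le> r" using z0 K(4) by (auto simp: r_def)
  have "uniformly_convergent_on K (\<lambda>N z. \<Prod>n<N. 1 - f z * g z ^ n)"
  proof (rule uniformly_convergent_on_prod'[OF _ K(1)])
    show "continuous_on K (\<lambda>z. 1 - f z * g z ^ n)" for n
      using K by (intro continuous_intros)
    show "uniformly_convergent_on K (\<lambda>N z. \<Sum>n<N. norm (1 - f z * g z ^ n - 1))"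
    proof (rule Weierstrass_m_test')
      show "norm (norm (1 - f z * g z ^ n - 1)) \<le> M * r ^ n" if "z \<in> K" for n z
      proof -
        have "norm (f z) * norm (g z) ^ n \<le> M * r ^ n"
          using M[OF that] r(3)[OF that] norm_ge_zero[of "f z"]
          by (intro mult_mono power_mono) (auto intro: order_trans[of _ "norm (f z)"])
        then show ?thesis by (simp add: norm_mult norm_power)
      qed
      show "summable (\<lambda>n. M * r ^ n)"
        using r by (intro summable_mult summable_geometric) auto
    qed
  qed
  then obtain l where l: "uniform_limit K (\<lambda>N z. \<Prod>n<N. 1 - f z * g z ^ n) l sequentially"
    by (auto simp: uniformly_convergent_on_def)
  have "l z = qp (f z) (g z)" if "z \<in> K" for z
    using tendsto_uniform_limitI[OF l that] qp_LIMSEQ[OF K(4)[OF that]] LIMSEQ_unique by blast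
  then show ?thesis using l by (simp cong: uniform_limit_cong')
qed auto

lemma holomorphic_on_qp [holomorphic_intros]:
  assumes "open S" "f holomorphic_on S" "g holomorphic_on S" "\<And>z. z \<in> S \<Longrightarrow> norm (g z) < 1"
  shows "(\<lambda>z. qp (f z) (g z)) holomorphic_on S"
proof (rule holomorphic_uniform_sequence[OF assms(1)])
  show "(\<lambda>z. \<Prod>n<N. 1 - f z * g z ^ n) holomorphic_on S" for N
    using assms by (intro holomorphic_intros)
  fix x assume "x \<in> S"
  then obtain d where d: "0 < d" "cball x d \<subseteq> S" using assms(1) open_contains_cball by blast
  have "continuous_on (cball x d) f" "continuous_on (cball x d) g"
    using assms d by (meson holomorphic_on_imp_continuous_on continuous_on_subset)+
  then show "\<exists>d>0. cball x d \<subseteq> S \<and>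
     uniform_limit (cball x d) (\<lambda>N z. \<Prod>n<N. 1 - f z * g z ^ n) (\<lambda>z. qp (f z) (g z)) sequentially"
    using d assms(4) by (intro exI[of _ d] conjI qp_uniform_limit) auto
qed

lemma qp_even_odd:
  assumes "norm q < 1"
  shows "qp a (q\<^sup>2) * qp (a * q) (q\<^sup>2) = qp a q"
proof (rule LIMSEQ_unique)
  have q2: "norm (q\<^sup>2) < 1" using assms by (simp add: norm_power abs_square_less_1)
  have "(\<Prod>n<2*N. 1 - a * q ^ n) = (\<Prod>n<N. 1 - a * (q\<^sup>2) ^ n) * (\<Prod>n<N. 1 - a * q * (q\<^sup>2) ^ n)" for N
  proof (induction N)
    case (Suc N)
    have "q ^ (2 * N) = (q\<^sup>2) ^ N" by (rule power_mult)
    then show ?case using Suc by (simp add: mult_ac)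
  qed auto
  moreover have "(\<lambda>N. \<Prod>n<2*N. 1 - a * q ^ n) \<longlonglongrightarrow> qp a q"
    using LIMSEQ_subseq_LIMSEQ[OF qp_LIMSEQ[OF assms], of "\<lambda>N. 2 * N" a]
    by (simp add: o_def strict_mono_def)
  ultimately show "(\<lambda>N. (\<Prod>n<N. 1 - a * (q\<^sup>2) ^ n) * (\<Prod>n<N. 1 - a * q * (q\<^sup>2) ^ n)) \<longlonglongrightarrow> qp a q"
    by simp
  show "(\<lambda>N. (\<Prod>n<N. 1 - a * (q\<^sup>2) ^ n) * (\<Prod>n<N. 1 - a * q * (q\<^sup>2) ^ n))
      \<longlonglongrightarrow> qp a (q\<^sup>2) * qp (a * q) (q\<^sup>2)"
    by (intro tendsto_mult qp_LIMSEQ q2)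
qed

lemma qp_minus:
  assumes "norm q < 1"
  shows "qp a q * qp (- a) q = qp (a\<^sup>2) (q\<^sup>2)"
proof (rule LIMSEQ_unique)
  have q2: "norm (q\<^sup>2) < 1" using assms by (simp add: norm_power abs_square_less_1)
  have "(\<Prod>n<N. 1 - a * q ^ n) * (\<Prod>n<N. 1 - (-a) * q ^ n) = (\<Prod>n<N. 1 - a\<^sup>2 * (q\<^sup>2) ^ n)" for N
    unfolding prod.distrib[symmetric]
    by (intro prod.cong refl) (simp add: algebra_simps power2_eq_square power_mult_distrib)
  then show "(\<lambda>N. (\<Prod>n<N. 1 - a * q ^ n) * (\<Prod>n<N. 1 - (-a) * q ^ n)) \<longlonglongrightarrow> qp (a\<^sup>2) (q\<^sup>2)"
    using qp_LIMSEQ[OF q2, of "a\<^sup>2"] by simp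
  show "(\<lambda>N. (\<Prod>n<N. 1 - a * q ^ n) * (\<Prod>n<N. 1 - (-a) * q ^ n)) \<longlonglongrightarrow> qp a q * qp (- a) q"
    by (intro tendsto_mult qp_LIMSEQ assms)
qed

text \<open>Euler's identity between partitions into distinct parts and partitions into odd parts,
  with \<open>q = h\<^sup>2\<close>.\<close>
lemma qp_Euler:
  assumes "norm h < 1"
  shows "qp h (h\<^sup>2) * qp (- h) (h\<^sup>2) * qp (- (h\<^sup>2)) (h\<^sup>2) = 1"
proof -
  define q where "q = h\<^sup>2"
  have q: "norm q < 1" using assms by (simp add: norm_power abs_square_less_1 q_def)
  \<comment> \<open>\<open>qp_minus\<close> turns the first two factors into the product of all 1 -
    q^(2n); the odd exponents complete it to \<open>qp q q\<close>, which then cancels.\<close>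
  have "qp q q * qp (- q) q * qp q (q\<^sup>2) = qp q q"
    using qp_minus[OF q, of q] qp_even_odd[OF q, of q] by (simp add: power2_eq_square mult.commute)
  then have "qp (- q) q * qp q (q\<^sup>2) = 1" using qp_self_nonzero[OF q] by (simp add: mult.assoc)
  then show ?thesis using qp_minus[OF q, of h] by (simp add: q_def mult.commute)
qed

section \<open>A theta function\<close>

definition ee :: "complex \<Rightarrow> complex" where
  "ee z = exp (2 * complex_of_real pi * \<i> * z)"

lemma ee_add: "ee (x + y) = ee x * ee y"
  by (simp add: ee_def algebra_simps exp_add)

lemma ee_minus: "ee (- x) = inverse (ee x)"
  by (simp add: ee_def exp_minus)

lemma ee_minus_half: "ee (- x / 2) = 1 / ee (x / 2)"
  using ee_minus[of "x / 2"] by (simp add: inverse_eq_divide)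

lemma ee_diff: "ee (x - y) = ee x / ee y"
  by (simp add: ee_def algebra_simps exp_diff)

lemma ee_nonzero [simp]: "ee x \<noteq> 0"
  by (simp add: ee_def)

lemma ee_0 [simp]: "ee 0 = 1"
  by (simp add: ee_def)

lemma ee_of_nat_mult: "ee (of_nat n * x) = ee x ^ n"
  by (simp add: ee_def exp_of_nat_mult[symmetric] mult_ac)

lemma ee_mult_of_nat: "ee (x * of_nat n) = ee x ^ n"
  using ee_of_nat_mult[of n x] by (simp add: mult.commute)

lemma ee_double: "ee (2 * x) = ee x ^ 2"
  using ee_of_nat_mult[of 2 x] by simp

lemma ee_1 [simp]: "ee 1 = 1"
  by (simp add: ee_def)

lemma ee_half [simp]: "ee (1 / 2) = - 1"
  by (simp add: ee_def exp_pi_i')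

lemma ee_quarter [simp]: "ee (1 / 4) = \<i>"
proof -
  have "ee (1/4) = exp (\<i> * complex_of_real (pi / 2))" by (simp add: ee_def mult_ac)
  then show ?thesis by (simp only: cis_conv_exp[symmetric] cis_pi_half)
qed

lemma norm_ee: "norm (ee x) = exp (- 2 * pi * Im x)"
  by (simp add: ee_def norm_exp_eq_Re)

lemma norm_ee_less_1: "Im x > 0 \<Longrightarrow> norm (ee x) < 1"
  by (simp add: norm_ee)

lemma ee_eq_1_iff: "ee x = 1 \<longleftrightarrow> x \<in> \<int>"
proof
  assume "ee x = 1"
  then obtain n :: int where "Re (2 * complex_of_real pi * \<i> * x) = 0"
    "Im (2 * complex_of_real pi * \<i> * x) = of_int (2 * n) * pi"
    unfolding ee_def exp_eq_1 by blast
  then have "x = of_int n" by (simp add: complex_eq_iff)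
  then show "x \<in> \<int>" by simp
next
  assume "x \<in> \<int>"
  then obtain n :: int where "x = of_int n" by (auto elim: Ints_cases)
  then show "ee x = 1" unfolding ee_def exp_eq_1 by (auto simp: mult_ac)
qed

lemma holomorphic_on_ee [holomorphic_intros]: "f holomorphic_on S \<Longrightarrow> (\<lambda>z. ee (f z)) holomorphic_on S"
  unfolding ee_def by (intro holomorphic_intros)

lemma Delta_eq: "Im z > 0 \<Longrightarrow> Delta z = ee z * qp (ee z) (ee z) ^ 24"
  using prodinf_power[OF convergent_prod_qp[OF norm_ee_less_1[of z]], of "ee z" 24]
  unfolding Delta_def qp_def Let_def ee_def[symmetric] power_Suc by simp

text \<open>Up to a factor depending only on \<open>t\<close>, this is Jacobi's theta function with a simple zero
  at each point of the lattice \<open>\<int> + \<int> t\<close>.\<close>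
definition theta :: "complex \<Rightarrow> complex \<Rightarrow> complex" where
  "theta z t = (ee (z / 2) - ee (- z / 2)) * (qp (ee t * ee z) (ee t) * qp (ee t / ee z) (ee t))"

lemma theta_add_1: "theta (z + 1) t = - theta z t"
proof -
  have "ee ((z + 1) / 2) = - ee (z / 2)"
    unfolding add_divide_distrib ee_add by simp
  moreover have "ee (- (z + 1) / 2) = - ee (- z / 2)"
    unfolding ee_minus_half using calculation by simp
  moreover have "ee (z + 1) = ee z" by (simp add: ee_add)
  ultimately show ?thesis unfolding theta_def by (simp add: algebra_simps)
qed

lemma theta_minus: "theta (- z) t = - theta z t"
proof -
  have "ee t * ee (- z) = ee t / ee z" "ee t / ee (- z) = ee t * ee z"
    by (simp_all add: ee_minus divide_inverse)
  then show ?thesis unfolding theta_def by (simp add: algebra_simps)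
qed

text \<open>The shift multiplies \<open>ee z\<close> by \<open>ee t\<close>: one product loses its
  first factor, the other gains a new one, and the ratio of these two factors accounts for the
  multiplier.\<close>

lemma theta_add_t:
  assumes "Im t > 0"
  shows "theta (z + t) t = - ee (- t / 2 - z) * theta z t"
proof -
  \<comment> \<open>With these square roots of \<open>ee z\<close> and \<open>ee t\<close> every
    factor becomes rational in \<open>s\<close> and \<open>u\<close>.\<close>
  define s u where "s = ee (z / 2)" and "u = ee (t / 2)"
  have nz: "s \<noteq> 0" "u \<noteq> 0" by (auto simp: s_def u_def)
  have w: "ee z = s\<^sup>2" and q: "ee t = u\<^sup>2"
    using ee_double[of "z/2"] ee_double[of "t/2"] by (auto simp: s_def u_def)
  have q1: "norm (u\<^sup>2) < 1" using norm_ee_less_1[OF assms] q by simp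
  define A B where "A = qp (u\<^sup>2 * (u\<^sup>2 * s\<^sup>2)) (u\<^sup>2)" and "B = qp (u\<^sup>2 / s\<^sup>2) (u\<^sup>2)"
  have 1: "qp (u\<^sup>2 * s\<^sup>2) (u\<^sup>2) = (1 - u\<^sup>2 * s\<^sup>2) * A"
    unfolding A_def by (subst qp_Suc[OF q1]) (simp add: mult_ac)
  have 2: "qp (1 / s\<^sup>2) (u\<^sup>2) = (1 - 1 / s\<^sup>2) * B"
    unfolding B_def by (subst qp_Suc[OF q1]) simp
  have e1: "ee ((z + t) / 2) = s * u" unfolding add_divide_distrib ee_add s_def u_def ..
  have e2: "ee (- (z + t) / 2) = 1 / (s * u)"
    unfolding ee_minus_half e1 ..
  have e3: "ee (- z / 2) = 1 / s" unfolding ee_minus_half s_def ..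
  have e4: "ee (- t / 2 - z) = 1 / (u * s\<^sup>2)"
    unfolding ee_diff ee_minus_half w by (simp add: u_def)
  have e5: "ee (z + t) = u\<^sup>2 * s\<^sup>2" by (simp add: ee_add w q mult_ac)
  have "theta (z + t) t = (s * u - 1 / (s * u)) * (A * ((1 - 1 / s\<^sup>2) * B))"
    unfolding theta_def e1 e2 e5 q A_def[symmetric]
    using nz 2 by (simp add: B_def)
  also have "\<dots> = - (1 / (u * s\<^sup>2)) * ((s - 1 / s) * ((1 - u\<^sup>2 * s\<^sup>2) * A * B))"
    using nz by (simp add: field_simps power2_eq_square)
  also have "\<dots> = - ee (- t / 2 - z) * theta z t"
    unfolding theta_def e3 e4 w q s_def[symmetric] 1 B_def[symmetric] by simp
  finally show ?thesis .
qed

text \<open>A convergent product vanishes only if one of its factors does, and each factor vanishes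
  only where \<open>ee (z + of_int n * t) = 1\<close> for some integer n.\<close>

lemma theta_eq_0_imp:
  assumes "Im t > 0" "theta z t = 0"
  obtains m n :: int where "z = of_int m + of_int n * t"
proof -
  have q1: "norm (ee t) < 1" using assms by (simp add: norm_ee_less_1)
  have zt: "ee (z + of_int n * t) = 1 \<Longrightarrow> thesis" for n :: int
    unfolding ee_eq_1_iff using that[of _ "- n"] by (force elim!: Ints_cases simp: algebra_simps)
  consider "ee (z / 2) = ee (- z / 2)" | "qp (ee t * ee z) (ee t) = 0" | "qp (ee t / ee z) (ee t) = 0"
    using assms(2) unfolding theta_def by auto
  then show ?thesis
  proof cases
    case 1
    have "ee (z / 2) * ee (z / 2) = ee (- (z / 2)) * ee (z / 2)" using 1 by simp
    then have "ee z = 1" unfolding ee_add[symmetric] by simp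
    then show ?thesis using zt[of 0] by simp
  next
    case 2
    then obtain n where "ee t * ee z * ee t ^ n = 1" using qp_nonzero[OF q1] by blast
    then have "ee (z + of_int (int n + 1) * t) = 1"
      by (simp add: ring_distribs ee_add ee_mult_of_nat mult_ac)
    then show ?thesis by (rule zt)
  next
    case 3
    then obtain n where "ee t / ee z * ee t ^ n = 1" using qp_nonzero[OF q1] by blast
    then have "ee z / (ee t * ee t ^ n) = 1" by (simp add: field_simps)
    then have "ee (z + of_int (- int n - 1) * t) = 1"
      by (simp add: ring_distribs ee_add ee_diff ee_minus ee_mult_of_nat mult_ac)
    then show ?thesis by (rule zt)
  qed
qed

lemma holomorphic_on_theta [holomorphic_intros]:
  assumes "open S" "Im t > 0" "f holomorphic_on S"
  shows "(\<lambda>z. theta (f z) t) holomorphic_on S"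
  unfolding theta_def using assms by (intro holomorphic_intros) (auto intro: norm_ee_less_1)

text \<open>At a half period z and -z agree modulo the lattice, so the two products coincide up to
  one factor and a square appears. This and the next two values are Jacobi's theta constants in the
  present normalisation.\<close>

lemma theta_half:
  "theta (1 / 2) t = 2 * \<i> * qp (- ee t) (ee t) ^ 2"
proof -
  have "ee (1 / 2 / 2) = \<i>" "ee (- (1 / 2) / 2) = - \<i>"
    unfolding ee_minus_half by simp_all
  then show ?thesis unfolding theta_def by (simp add: power2_eq_square)
qed

lemma theta_half_t:
  assumes "Im t > 0"
  shows "theta (t / 2) t = - (1 / ee (t / 4)) * qp (ee (t / 2)) (ee t) ^ 2"
proof -
  have q1: "norm (ee t) < 1" using assms by (simp add: norm_ee_less_1)
  define k where "k = ee (t / 4)"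
  have k0: "k \<noteq> 0" by (simp add: k_def)
  have u: "ee (t / 2) = k\<^sup>2" using ee_double[of "t/4"] by (simp add: k_def)
  have q: "ee t = (k\<^sup>2)\<^sup>2" using ee_double[of "t/2"] u by simp
  have e: "ee (t / 2 / 2) = k" "ee (- (t / 2) / 2) = 1 / k"
    unfolding ee_minus_half by (simp_all add: k_def)
  have "qp (k\<^sup>2) (ee t) = (1 - k\<^sup>2) * qp (ee t * k\<^sup>2) (ee t)"
    by (subst qp_Suc[OF q1]) (simp add: mult_ac)
  moreover have "ee t / k\<^sup>2 = k\<^sup>2" using k0 by (simp add: q power2_eq_square)
  moreover have "k - 1 / k = - (1 / k) * (1 - k\<^sup>2)" using k0 by (simp add: field_simps power2_eq_square)
  ultimately show ?thesis unfolding theta_def u e k_def[symmetric] by (simp add: power2_eq_square)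
qed

lemma theta_half_add_half_t:
  assumes "Im t > 0"
  shows "theta ((1 + t) / 2) t = \<i> / ee (t / 4) * qp (- ee (t / 2)) (ee t) ^ 2"
proof -
  have q1: "norm (ee t) < 1" using assms by (simp add: norm_ee_less_1)
  define k where "k = ee (t / 4)"
  have k0: "k \<noteq> 0" by (simp add: k_def)
  have u: "ee (t / 2) = k\<^sup>2" using ee_double[of "t/4"] by (simp add: k_def)
  have q: "ee t = (k\<^sup>2)\<^sup>2" using ee_double[of "t/2"] u by simp
  have e1: "ee ((1 + t) / 2 / 2) = \<i> * k"
    using ee_add[of "1/4" "t/4"] by (simp add: k_def add_divide_distrib)
  have e2: "ee (- ((1 + t) / 2) / 2) = - \<i> / k"
    unfolding ee_minus_half e1 by (simp add: divide_simps)
  have u': "ee ((1 + t) / 2) = - k\<^sup>2" using ee_add[of "1/2" "t/2"] u by (simp add: add_divide_distrib)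
  have "qp (- (k\<^sup>2)) (ee t) = (1 + k\<^sup>2) * qp (- (ee t * k\<^sup>2)) (ee t)"
    by (subst qp_Suc[OF q1]) (simp add: mult_ac)
  moreover have "ee t / (- (k\<^sup>2)) = - (k\<^sup>2)" using k0 by (simp add: q power2_eq_square)
  moreover have "\<i> * k - (- \<i> / k) = \<i> / k * (1 + k\<^sup>2)" using k0 by (simp add: field_simps power2_eq_square)
  ultimately show ?thesis unfolding theta_def u u' e1 e2 k_def[symmetric] by (simp add: power2_eq_square)
qed

text \<open>Jacobi's identity for the product of the three theta constants: Euler's identity cancels
  all infinite products and leaves an exponential.\<close>

lemma theta_half_periods_prod:
  assumes "Im t > 0"
  shows "theta (1 / 2) t * theta (t / 2) t * theta ((1 + t) / 2) t = 2 / ee (t / 2)"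
proof -
  define h where "h = ee (t / 2)"
  have q: "ee t = h\<^sup>2" and h: "h = (ee (t / 4))\<^sup>2"
    using ee_double[of "t/2"] ee_double[of "t/4"] by (simp_all add: h_def)
  have h1: "norm h < 1" using assms by (simp add: h_def norm_ee_less_1)
  define A B C where "A = qp h (h\<^sup>2)" and "B = qp (- h) (h\<^sup>2)" and "C = qp (- (h\<^sup>2)) (h\<^sup>2)"
  have ABC: "A * B * C = 1" using qp_Euler[OF h1] by (simp add: A_def B_def C_def)
  have "theta (1 / 2) t * theta (t / 2) t * theta ((1 + t) / 2) t
     = (2 * \<i> * C ^ 2) * (- (1 / ee (t / 4)) * A ^ 2) * (\<i> / ee (t / 4) * B ^ 2)"
    unfolding theta_half theta_half_t[OF assms] theta_half_add_half_t[OF assms] q h_def[symmetric]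
      A_def B_def C_def ..
  also have "\<dots> = 2 / (ee (t / 4))\<^sup>2 * (A * B * C) ^ 2"
    by (simp add: field_simps power2_eq_square)
  finally show ?thesis using ABC h by (simp add: h_def)
qed

section \<open>Modularity of the product\<close>

lemma theta_0 [simp]: "theta 0 t = 0"
  by (simp add: theta_def)

text \<open>The cofactor \<open>R\<close> does not vanish at 0. It serves both to isolate the zero
  there and to compute limits of quotients of theta functions.\<close>

lemma theta_simple_zero:
  assumes "Im t > 0"
  obtains R where "R holomorphic_on UNIV" "\<And>z. theta z t = (ee (z / 2) - ee (- z / 2)) * R z"
    "R 0 = qp (ee t) (ee t) ^ 2"
proof
  show "(\<lambda>z. qp (ee t * ee z) (ee t) * qp (ee t / ee z) (ee t)) holomorphic_on UNIV"
    using assms by (intro holomorphic_intros) (auto intro: norm_ee_less_1)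
qed (simp_all add: theta_def power2_eq_square)

lemma ee_diff_slope:
  fixes a :: complex
  shows "((\<lambda>z. (ee (a * z / 2) - ee (- (a * z) / 2)) / z) \<longlongrightarrow> 2 * pi * \<i> * a) (at 0)"
proof -
  have "((\<lambda>z. ee (a * z / 2) - ee (- (a * z) / 2)) has_field_derivative 2 * pi * \<i> * a) (at 0)"
    unfolding ee_def by (auto intro!: derivative_eq_intros simp: field_simps)
  then show ?thesis unfolding has_field_derivative_iff by simp
qed

text \<open>\<open>G / \<theta>\<close> is invariant under the lattice \<open>\<int> + \<int> t\<close>, so a finite limit at \<open>0\<close> makes all of its
  singularities removable.\<close>
lemma theta_quotient_constant:
  assumes t: "Im t > 0"
    and G: "G holomorphic_on UNIV"
    and G1: "\<And>z. G (z + 1) = - G z"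
    and Gt: "\<And>z. G (z + t) = - ee (- t / 2 - z) * G z"
    and lim: "((\<lambda>z. G z / theta z t) \<longlongrightarrow> c) (at 0)"
  shows "theta z t \<noteq> 0 \<Longrightarrow> G z = c * theta z t"
proof -
  \<comment> \<open>Lattice invariance forces the same value at every zero of theta, so the limit
    \<open>c\<close> at 0 is the only possible filling.\<close>
  define H where "H = (\<lambda>z. if theta z t = 0 then c else G z / theta z t)"
  have H1: "H (z + 1) = H z" for z by (simp add: H_def G1 theta_add_1)
  have Ht: "H (z + t) = H z" for z by (simp add: H_def Gt theta_add_t[OF t])
  have Hm: "H (z + of_int m) = H z" for z m
  proof (induction m rule: int_induct[of _ 0])
    case (step1 i) then show ?case using H1[of "z + of_int i"] by (simp add: add_ac)
  next
    case (step2 i) then show ?case using H1[of "z + of_int (i - 1)"] by simp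
  qed simp
  have Hn: "H (z + of_int n * t) = H z" for z n
  proof (induction n rule: int_induct[of _ 0])
    case (step1 i) then show ?case using Ht[of "z + of_int i * t"] by (simp add: algebra_simps)
  next
    case (step2 i) then show ?case using Ht[of "z + of_int (i - 1) * t"] by (simp add: algebra_simps)
  qed simp
  have Hmn: "H (z + (of_int m + of_int n * t)) = H z" for z m n
    using Hn[of "z + of_int m" n] Hm[of z m] by (simp add: add_ac)

  have th: "(\<lambda>z. theta z t) holomorphic_on UNIV"
    using t by (intro holomorphic_intros) auto
  have op: "open {z. theta z t \<noteq> 0}"
    using open_Collect_neq[OF holomorphic_on_imp_continuous_on[OF th] continuous_on_const[of _ 0]] by simp

  obtain R where R: "R holomorphic_on UNIV" "\<And>z. theta z t = (ee (z / 2) - ee (- z / 2)) * R z"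
    "R 0 = qp (ee t) (ee t) ^ 2" using theta_simple_zero[OF t] by blast
  have "open {z. R z \<noteq> 0}"
    using open_Collect_neq[OF holomorphic_on_imp_continuous_on[OF R(1)] continuous_on_const[of _ 0]] by simp
  moreover have "R 0 \<noteq> 0" using R(3) qp_self_nonzero[OF norm_ee_less_1[OF t]] by simp
  ultimately obtain r0 where r0: "r0 > 0" "ball 0 r0 \<subseteq> {z. R z \<noteq> 0}"
    by (metis (mono_tags, lifting) mem_Collect_eq open_contains_ball)
  \<comment> \<open>In the unit disc 0 is the only integer, hence the only zero of the factor
    \<open>ee (z / 2) - ee (- z / 2)\<close>.\<close>
  define r where "r = min r0 1"
  have r: "r > 0" using r0 by (simp add: r_def)
  have nz: "theta z t \<noteq> 0" if z: "z \<in> ball 0 r - {0}" for z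
  proof
    assume "theta z t = 0"
    then have "ee (z / 2) = ee (- (z / 2))" using R(2) r0 z by (auto simp: r_def)
    then have "ee (z / 2) * ee (z / 2) = ee (- (z / 2)) * ee (z / 2)" by simp
    then have "ee z = 1" unfolding ee_add[symmetric] by simp
    then obtain n :: int where n: "z = of_int n" unfolding ee_eq_1_iff by (auto elim: Ints_cases)
    then have "norm z = \<bar>of_int n\<bar>" by simp
    then have "\<bar>n\<bar> < 1" using z by (auto simp: r_def n)
    then show False using z n by auto
  qed
  have H0: "H holomorphic_on ball 0 r"
  proof -
    have "(\<lambda>z. if z = 0 then c else G z / theta z t) holomorphic_on ball 0 r"
      using nz lim holomorphic_on_subset[OF G] holomorphic_on_subset[OF th]
      by (intro removable_singularity holomorphic_on_divide) auto
    then show ?thesis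
      by (rule holomorphic_transform) (use nz in \<open>auto simp: H_def\<close>)
  qed
  have "H field_differentiable (at z0)" for z0
  proof (cases "theta z0 t = 0")
    case True
    then obtain m n :: int where mn: "z0 = of_int m + of_int n * t" using theta_eq_0_imp[OF t] by blast
    have "H field_differentiable (at (z0 - z0))"
      using H0 r by (simp add: holomorphic_on_imp_differentiable_at)
    then have "(\<lambda>z. H (z - z0)) field_differentiable (at z0)"
      using field_differentiable_compose[of "\<lambda>z. z - z0" z0 H]
      by (simp add: o_def field_differentiable_diff)
    moreover have "H (z - z0) = H z" for z using Hmn[of "z - z0" m n] mn by simp
    ultimately show ?thesis by simp
  next
    case False
    have "(\<lambda>z. G z / theta z t) holomorphic_on {z. theta z t \<noteq> 0}"
      using holomorphic_on_subset[OF G] holomorphic_on_subset[OF th]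
      by (intro holomorphic_on_divide) auto
    then have "H holomorphic_on {z. theta z t \<noteq> 0}"
      by (rule holomorphic_transform) (auto simp: H_def)
    then show ?thesis using op False holomorphic_on_imp_differentiable_at by blast
  qed
  then have H: "H holomorphic_on UNIV" by (simp add: holomorphic_on_def)

  define K where "K = (\<lambda>(x, y). complex_of_real x + of_real y * t) ` ({0..1} \<times> {0..1})"
  have "compact K" unfolding K_def
    by (intro compact_continuous_image compact_Times) (auto simp: case_prod_beta intro!: continuous_intros)
  then have "bounded (H ` K)"
    by (intro compact_imp_bounded compact_continuous_image)
       (use H in \<open>auto intro: continuous_on_subset[OF holomorphic_on_imp_continuous_on]\<close>)
  moreover have "range H \<subseteq> H ` K"
  proof safe
    fix z
    define y where "y = Im z / Im t"
    define x where "x = Re (z - y * t)"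
    have z: "z = x + y * t" using t by (simp add: complex_eq_iff x_def y_def)
    have "z = (frac x + frac y * t) + (of_int \<lfloor>x\<rfloor> + of_int \<lfloor>y\<rfloor> * t)"
      by (subst z) (simp add: frac_def algebra_simps)
    then have "H z = H (frac x + frac y * t)" using Hmn by metis
    moreover have "frac x + frac y * t \<in> K"
      unfolding K_def by (rule image_eqI[of _ _ "(frac x, frac y)"])
        (auto simp: frac_lt_1 less_imp_le)
    ultimately show "H z \<in> H ` K" by blast
  qed
  ultimately have "bounded (range H)" by (rule bounded_subset)
  then have "H constant_on UNIV" using Liouville_theorem[OF H] by blast
  then obtain y where "H z = y" for z unfolding constant_on_def by blast
  then have "H z = H 0" for z by simp
  then show "theta z t \<noteq> 0 \<Longrightarrow> G z = c * theta z t"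
    by (metis H_def nonzero_divide_eq_eq theta_0)
qed

theorem Delta_inversion:
  assumes t: "Im t > 0"
  shows "Delta (- 1 / t) = t ^ 12 * Delta t"
proof -
  define t' where "t' = - 1 / t"
  have t0: "t \<noteq> 0" using t by auto
  have t': "Im t' > 0"
    using t by (auto simp: t'_def Im_divide intro!: divide_pos_pos add_nonneg_pos)
  have tt: "t * t' = - 1" using t0 by (simp add: t'_def)
  define P P' where "P = qp (ee t) (ee t)" and "P' = qp (ee t') (ee t')"
  have P: "P \<noteq> 0" using qp_self_nonzero[OF norm_ee_less_1[OF t]] by (simp add: P_def)
  \<comment> \<open>The Gaussian factor converts the quasi-periods of theta at t', rescaled by t,
    into those of theta at t.\<close>
  define G where "G = (\<lambda>z. ee (- z\<^sup>2 / (2 * t)) * theta (z / t) t')"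
  \<comment> \<open>Ratio of the slopes at 0: theta at t has slope 2 pi i P^2, and the substitution
    z / t contributes 1 / t.\<close>
  define c where "c = (1 / t) * (P' / P)\<^sup>2"
  have G_hol: "G holomorphic_on UNIV"
    unfolding G_def using t' t0 by (intro holomorphic_intros) auto
  have Gt: "G (z + t) = - ee (- t / 2 - z) * G z" for z
  proof -
    have 1: "- (z + t)\<^sup>2 / (2 * t) = - z\<^sup>2 / (2 * t) + (- t / 2 - z)"
      using t0 by (simp add: field_simps power2_eq_square)
    have 2: "(z + t) / t = z / t + 1" using t0 by (simp add: field_simps)
    show ?thesis unfolding G_def 1 2 theta_add_1 ee_add by simp
  qed
  have G1: "G (z + 1) = - G z" for z
  proof -
    have 1: "- (z + 1)\<^sup>2 / (2 * t) = - z\<^sup>2 / (2 * t) + (- t' / 2 - (z + 1) / t)"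
      using t0 by (simp add: t'_def field_simps power2_eq_square)
    \<comment> \<open>Shifting z by 1 shifts z / t by -t', so the quasi-period of theta at t' is
      applied backwards.\<close>
    have 2: "z / t = (z + 1) / t + t'" using t0 by (simp add: field_simps t'_def)
    have "G (z + 1) = ee (- z\<^sup>2 / (2 * t)) * ee (- t' / 2 - (z + 1) / t) * theta ((z + 1) / t) t'"
      unfolding G_def 1 ee_add ..
    moreover have "G z = ee (- z\<^sup>2 / (2 * t)) * theta ((z + 1) / t + t') t'"
      unfolding G_def 2 ..
    ultimately show ?thesis unfolding theta_add_t[OF t'] by simp
  qed
  obtain R where R: "R holomorphic_on UNIV" "\<And>z. theta z t = (ee (z / 2) - ee (- z / 2)) * R z"
    "R 0 = P\<^sup>2" unfolding P_def using theta_simple_zero[OF t] by blast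
  obtain R' where R': "R' holomorphic_on UNIV" "\<And>z. theta z t' = (ee (z / 2) - ee (- z / 2)) * R' z"
    "R' 0 = P'\<^sup>2" unfolding P'_def using theta_simple_zero[OF t'] by blast
  have lim: "((\<lambda>z. G z / theta z t) \<longlongrightarrow> c) (at 0)"
  proof -
    have cont: "isCont f z" if "f holomorphic_on UNIV" for f :: "complex \<Rightarrow> complex" and z
      using that by (metis UNIV_I continuous_on_eq_continuous_at holomorphic_on_imp_continuous_on open_UNIV)
    have "isCont (\<lambda>z. R' (z / t)) 0"
      using cont[OF R'(1), of 0] by (intro isCont_o2[where f = "\<lambda>z. z / t" and g = R'] continuous_intros) (auto simp: t0)
    then have l1: "((\<lambda>z. R' (z / t)) \<longlongrightarrow> P'\<^sup>2) (at 0)" by (simp add: isCont_def R'(3))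
    have l2: "(R \<longlongrightarrow> P\<^sup>2) (at 0)" using cont[OF R(1), of 0] by (simp add: isCont_def R(3))
    have "isCont (\<lambda>z. ee (- z\<^sup>2 / (2 * t))) 0"
      by (rule cont) (use t0 in \<open>intro holomorphic_intros, auto\<close>)
    then have l3: "((\<lambda>z. ee (- z\<^sup>2 / (2 * t))) \<longlongrightarrow> 1) (at 0)" by (simp add: isCont_def)
    note l4 = ee_diff_slope[of "1 / t"] and l5 = ee_diff_slope[of 1]
    have "((\<lambda>z. ee (- z\<^sup>2 / (2 * t)) * (((ee (1 / t * z / 2) - ee (- (1 / t * z) / 2)) / z) * R' (z / t)) /
        (((ee (1 * z / 2) - ee (- (1 * z) / 2)) / z) * R z)) \<longlongrightarrow>
        1 * ((2 * pi * \<i> * (1 / t)) * P'\<^sup>2) / ((2 * pi * \<i> * 1) * P\<^sup>2)) (at 0)"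
      by (intro tendsto_intros l1 l2 l3 l4 l5) (use P in auto)
    moreover have "1 * ((2 * pi * \<i> * (1 / t)) * P'\<^sup>2) / ((2 * pi * \<i> * 1) * P\<^sup>2) = c"
      using t0 P by (simp add: c_def field_simps)
    moreover have "ee (- z\<^sup>2 / (2 * t)) * (((ee (1 / t * z / 2) - ee (- (1 / t * z) / 2)) / z) * R' (z / t)) /
        (((ee (1 * z / 2) - ee (- (1 * z) / 2)) / z) * R z) = G z / theta z t" if "z \<noteq> 0" for z
      using that t0 unfolding G_def R(2) R'(2) by simp
    ultimately show ?thesis
      by (smt (verit, ccfv_SIG) LIM_cong)
  qed
  have Gc: "G z = c * theta z t" if "theta z t \<noteq> 0" for z
    by (rule theta_quotient_constant[OF t G_hol G1 Gt lim that])
  have prod_t: "theta (1 / 2) t * theta (t / 2) t * theta ((1 + t) / 2) t = 2 / ee (t / 2)"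
    by (rule theta_half_periods_prod[OF t])
  then have "theta (1 / 2) t \<noteq> 0" "theta (t / 2) t \<noteq> 0" "theta ((1 + t) / 2) t \<noteq> 0" by auto
  then have "G (1 / 2) * G (t / 2) * G ((1 + t) / 2)
      = c ^ 3 * (theta (1 / 2) t * theta (t / 2) t * theta ((1 + t) / 2) t)"
    by (simp add: Gc power3_eq_cube)
  then have 1: "G (1 / 2) * G (t / 2) * G ((1 + t) / 2) = c ^ 3 * (2 / ee (t / 2))"
    unfolding prod_t .
  \<comment> \<open>Up to sign and lattice translation, z -> z / t exchanges the first two half
    periods and keeps the third.\<close>
  have g1: "G (1 / 2) = - ee (t' / 8) * theta (t' / 2) t'"
  proof -
    have e: "1 / 2 / t = - (t' / 2)" "- (1 / 2)\<^sup>2 / (2 * t) = t' / 8"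
      using t0 by (simp_all add: t'_def field_simps power2_eq_square)
    show ?thesis unfolding G_def e by (simp add: theta_minus)
  qed
  have g2: "G (t / 2) = ee (- t / 8) * theta (1 / 2) t'"
  proof -
    have e: "t / 2 / t = 1 / 2" "- (t / 2)\<^sup>2 / (2 * t) = - t / 8"
      using t0 by (simp_all add: field_simps power2_eq_square)
    show ?thesis unfolding G_def e ..
  qed
  have g3: "G ((1 + t) / 2) = ee (t' / 8 - 1 / 4 - t / 8) * theta ((1 + t') / 2) t'"
  proof -
    have e: "(1 + t) / 2 / t = - ((t' - 1) / 2)" "- ((1 + t) / 2)\<^sup>2 / (2 * t) = t' / 8 - 1 / 4 - t / 8"
      using t0 by (simp_all add: t'_def field_simps power2_eq_square)
    have "theta (- ((t' - 1) / 2)) t' = theta ((t' - 1) / 2 + 1) t'"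
      by (simp only: theta_minus theta_add_1)
    also have "(t' - 1) / 2 + 1 = (1 + t') / 2" by (simp add: field_simps)
    finally show ?thesis unfolding G_def e by simp
  qed
  have "G (1 / 2) * G (t / 2) * G ((1 + t) / 2) = - ee (t' / 8 + - t / 8 + (t' / 8 - 1 / 4 - t / 8)) *
     (theta (1 / 2) t' * theta (t' / 2) t' * theta ((1 + t') / 2) t')"
    unfolding g1 g2 g3 ee_add by simp
  also have "\<dots> = - ee (t' / 8 + - t / 8 + (t' / 8 - 1 / 4 - t / 8)) * (2 / ee (t' / 2))"
    unfolding theta_half_periods_prod[OF t'] ..
  finally have "c ^ 3 * 2 / ee (t / 2) = - ee (t' / 8 + - t / 8 + (t' / 8 - 1 / 4 - t / 8)) * 2 / ee (t' / 2)"
    unfolding 1 by simp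
  then have "c ^ 3 = - (ee (t' / 8 + - t / 8 + (t' / 8 - 1 / 4 - t / 8)) * ee (t / 2) / ee (t' / 2))"
    by (simp add: field_simps)
  also have "\<dots> = - ee ((t - t') / 4 - 1 / 4)"
    unfolding ee_add[symmetric] ee_diff[symmetric] by (intro arg_cong[of _ _ uminus] arg_cong[of _ _ ee]) (simp add: field_simps)
  \<comment> \<open>The fourth power removes the sign and makes the shift by 1/4 an integer.\<close>
  finally have "(c ^ 3) ^ 4 = ee ((t - t') / 4 - 1 / 4) ^ 4" by simp
  also have "\<dots> = ee (of_nat 4 * ((t - t') / 4 - 1 / 4))" unfolding ee_of_nat_mult ..
  also have "of_nat 4 * ((t - t') / 4 - 1 / 4) = (t - t') - 1" by simp
  finally have "c ^ 12 = ee t / ee t'" by (simp add: ee_diff flip: power_mult)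
  moreover have "c ^ 12 = P' ^ 24 / (t ^ 12 * P ^ 24)"
    by (simp add: c_def power_mult_distrib power_divide flip: power_mult)
  ultimately have "P' ^ 24 * ee t' = t ^ 12 * (ee t * P ^ 24)"
    using t0 P by (simp add: field_simps)
  then show ?thesis
    using Delta_eq[OF t] Delta_eq[OF t'] unfolding P_def P'_def t'_def by (simp add: mult.commute)
qed

lemma Delta_add_1: "Im z > 0 \<Longrightarrow> Delta (z + 1) = Delta z"
  by (simp add: Delta_eq ee_add)

lemma Delta_nonzero: "Im z > 0 \<Longrightarrow> Delta z \<noteq> 0"
  using qp_self_nonzero[OF norm_ee_less_1] by (simp add: Delta_eq)

section \<open>The Hecke operator at 2\<close>

definition mob :: "int \<Rightarrow> int \<Rightarrow> int \<Rightarrow> int \<Rightarrow> complex \<Rightarrow> complex" where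
  "mob a b c d z = (of_int a * z + of_int b) / (of_int c * z + of_int d)"

lemma mob_denom_nonzero:
  assumes "a * d - b * c = 1" "Im z > 0"
  shows "of_int c * z + of_int d \<noteq> 0"
proof
  assume h: "of_int c * z + of_int d = 0"
  then have "Im (of_int c * z + of_int d) = 0" "Re (of_int c * z + of_int d) = 0" by simp_all
  then have "c = 0" "d = 0" using assms(2) by (auto split: if_splits)
  then show False using assms(1) by simp
qed

lemma Im_mob:
  assumes "a * d - b * c = 1"
  shows "Im (mob a b c d z) = Im z / (norm (of_int c * z + of_int d))\<^sup>2"
proof -
  have "Im (mob a b c d z) = of_int (a * d - b * c) * Im z / (norm (of_int c * z + of_int d))\<^sup>2"
    by (simp add: mob_def Im_divide cmod_power2 algebra_simps)
  then show ?thesis using assms by simp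
qed

lemma Im_mob_pos:
  assumes "a * d - b * c = 1" "Im z > 0"
  shows "Im (mob a b c d z) > 0"
  using mob_denom_nonzero[OF assms] assms by (simp add: Im_mob)

lemma mob_compose:
  assumes "a' * d' - b' * c' = 1" "Im z > 0" "a * d - b * c = 1"
  shows "mob a b c d (mob a' b' c' d' z)
    = mob (a * a' + b * c') (a * b' + b * d') (c * a' + d * c') (c * b' + d * d') z"
proof -
  have 1: "of_int c' * z + of_int d' \<noteq> 0" using mob_denom_nonzero[OF assms(1,2)] .
  have 2: "of_int c * mob a' b' c' d' z + of_int d \<noteq> 0"
    using mob_denom_nonzero[OF assms(3) Im_mob_pos[OF assms(1,2)]] .
  have 3: "(of_int c * mob a' b' c' d' z + of_int d) * (of_int c' * z + of_int d')
      = of_int (c * a' + d * c') * z + of_int (c * b' + d * d')"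
    using 1 by (simp add: mob_def field_simps)
  have 4: "(of_int a * mob a' b' c' d' z + of_int b) * (of_int c' * z + of_int d')
      = of_int (a * a' + b * c') * z + of_int (a * b' + b * d')"
    using 1 by (simp add: mob_def field_simps)
  show ?thesis
    unfolding mob_def[of a] mob_def[of "_ * a' + _"] 3[symmetric] 4[symmetric]
    using 1 2 by simp
qed

lemma Delta_add_int: "Im z > 0 \<Longrightarrow> Delta (z + of_int n) = Delta z"
proof (induction n rule: int_induct[of _ 0])
  case (step1 i) then show ?case using Delta_add_1[of "z + of_int i"] by (simp add: add_ac)
next
  case (step2 i) then show ?case using Delta_add_1[of "z + of_int (i - 1)"] by simp
qed simp

text \<open>Euclid's algorithm on the bottom row reduces the matrix to translations and the
  inversion. The factors of automorphy multiply by the cocycle rule.\<close>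

theorem Delta_mob:
  assumes "a * d - b * c = 1" "Im z > 0"
  shows "Delta (mob a b c d z) = (of_int c * z + of_int d) ^ 12 * Delta z"
  using assms
proof (induction "nat \<bar>c\<bar>" arbitrary: a b c d z rule: less_induct)
  case less
  show ?case
  proof (cases "c = 0")
    case True
    then have "a * d = 1" using less.prems by simp
    then have "a = 1 \<and> d = 1 \<or> a = -1 \<and> d = -1" using pos_zmult_eq_1_iff_lemma zmult_eq_1_iff by blast
    then show ?thesis
    proof
      assume "a = 1 \<and> d = 1"
      then show ?thesis using True Delta_add_int[of z b] less.prems by (simp add: mob_def)
    next
      assume *: "a = -1 \<and> d = -1"
      have "(- z + of_int b) / (- 1) = z + of_int (- b)" by (simp add: field_simps)
      then show ?thesis using * True Delta_add_int[of z "-b"] less.prems by (simp add: mob_def)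
    qed
  next
    case False
    define q r where "q = d div c" and "r = d mod c"
    have d: "d = q * c + r" by (simp add: q_def r_def)
    have lt: "nat \<bar>r\<bar> < nat \<bar>c\<bar>" using False abs_mod_less[of c d] by (simp add: r_def)
    define z' where "z' = z + of_int q"
    have z'_pos: "Im z' > 0" using less.prems by (simp add: z'_def)
    then have z': "Im z' > 0" "z' \<noteq> 0" by auto
    define w where "w = - 1 / z'"
    have w: "Im w > 0" unfolding w_def using Im_mob_pos[of 0 0 "-1" 1 z'] z' by (simp add: mob_def)
    \<comment> \<open>The matrix with rows (b', -a) and (r, -c) is the given one times T^(-q) S, for
      the translation T and inversion S; its lower left entry is the remainder.\<close>
    define b' where "b' = b - q * a"
    have det: "b' * (- c) - (- a) * r = 1" using less.prems(1) by (simp add: b'_def d algebra_simps)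
    have nz: "of_int r * w + of_int (- c) \<noteq> 0" using mob_denom_nonzero[OF det w] .
    have num: "(of_int b' * w + of_int (- a)) * (- z') = of_int a * z + of_int b"
      and den: "(of_int r * w + of_int (- c)) * (- z') = of_int c * z + of_int d"
      using z' by (simp_all add: w_def b'_def d z'_def field_simps)
    have "mob a b c d z = mob b' (- a) r (- c) w"
      unfolding mob_def num[symmetric] den[symmetric] using z' nz by simp
    then have "Delta (mob a b c d z) = (of_int r * w + of_int (- c)) ^ 12 * Delta w"
      using less.hyps[OF lt det w] by simp
    also have "Delta w = z' ^ 12 * Delta z"
      unfolding w_def Delta_inversion[OF z'(1)] using Delta_add_int less.prems by (simp add: z'_def)
    also have "(of_int r * w + of_int (- c)) ^ 12 * (z' ^ 12 * Delta z)
        = ((of_int r * w + of_int (- c)) * (- z')) ^ 12 * Delta z"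
      by (simp add: power_mult_distrib)
    finally show ?thesis unfolding den .
  qed
qed

section \<open>Behaviour of the product at q = 0\<close>

lemma holomorphic_on_qp_self: "(\<lambda>q. qp q q) holomorphic_on ball 0 1"
  by (intro holomorphic_intros) auto

lemma qp_self_0 [simp]: "qp 0 0 = 1"
  by (simp add: qp_def)

text \<open>The 24th power then has linear coefficient -24, from which the Hecke eigenvalue is read
  off. Locally uniform convergence carries the derivative from the partial products to the
  limit.\<close>

lemma deriv_qp_self_0: "((\<lambda>q. qp q q) has_field_derivative - 1) (at 0)"
proof -
  define f where "f = (\<lambda>N q. \<Prod>n<N. 1 - q * q ^ n :: complex)"
  have hol: "f N holomorphic_on ball 0 1" for N
    unfolding f_def by (intro holomorphic_intros)
  have "\<exists>g'. \<forall>x\<in>ball 0 1. ((\<lambda>q. qp q q) has_field_derivative g' x) (at x) \<and>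
      (\<lambda>n. deriv (f n) x) \<longlonglongrightarrow> g' x"
  proof (rule has_complex_derivative_uniform_sequence)
    fix x :: complex assume "x \<in> ball 0 1"
    then obtain d where d: "d > 0" "cball x d \<subseteq> ball 0 1"
      by (meson open_ball open_contains_cball)
    then show "\<exists>d. 0 < d \<and> cball x d \<subseteq> ball 0 1 \<and> uniform_limit (cball x d) f (\<lambda>q. qp q q) sequentially"
      unfolding f_def by (intro exI[of _ d] conjI qp_uniform_limit) (auto intro: continuous_intros)
  next
    fix n x assume "x \<in> ball (0::complex) 1"
    then show "(f n has_field_derivative deriv (f n) x) (at x)"
      using hol holomorphic_derivI open_ball by blast
  qed auto
  then obtain g' where g': "((\<lambda>q. qp q q) has_field_derivative g') (at 0)" "(\<lambda>n. deriv (f n) 0) \<longlonglongrightarrow> g'"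
    by (metis centre_in_ball zero_less_one)
  \<comment> \<open>Only the factor 1 - q affects the linear term. The empty product
    \<open>f 0\<close> has derivative 0, hence the index shift.\<close>
  have "(f (Suc N) has_field_derivative - 1) (at 0)" for N
  proof (induction N)
    case 0
    have "((\<lambda>q::complex. 1 - q) has_field_derivative - 1) (at 0)"
      by (auto intro!: derivative_eq_intros)
    then show ?case by (simp add: f_def)
  next
    case (Suc N)
    have "((\<lambda>q. f (Suc N) q * (1 - q * q ^ Suc N)) has_field_derivative - 1) (at 0)"
      by (rule derivative_eq_intros Suc refl | simp)+
    then show ?case by (simp add: f_def)
  qed
  then have "deriv (f (Suc n)) 0 = - 1" for n by (rule DERIV_imp_deriv)
  then have "(\<lambda>n. deriv (f (Suc n)) 0) \<longlonglongrightarrow> - 1" by simp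
  then have "(\<lambda>n. deriv (f n) 0) \<longlonglongrightarrow> - 1" by (rule LIMSEQ_imp_Suc)
  then show ?thesis using g' LIMSEQ_unique by blast
qed

lemma holomorphic_on_Delta: "Delta holomorphic_on {z. Im z > 0}"
proof -
  have "(\<lambda>z. ee z * qp (ee z) (ee z) ^ 24) holomorphic_on {z. Im z > 0}"
    by (intro holomorphic_intros open_halfspace_Im_gt) (auto intro: norm_ee_less_1)
  then show ?thesis by (rule holomorphic_transform) (auto simp: Delta_eq)
qed

lemma Delta_bound:
  obtains C where "C \<ge> 0" "\<And>z. Im z \<ge> 1 \<Longrightarrow> norm (Delta z) \<le> C * exp (- 2 * pi * Im z)"
proof -
  define K where "K = cball (0::complex) (exp (- 2 * pi))"
  have K: "compact K" "K \<subseteq> ball 0 1" 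
  proof -
    have "exp (- 2 * pi) < 1" by simp
    then show "K \<subseteq> ball 0 1" unfolding K_def cball_subset_ball_iff by simp
  qed (simp add: K_def)
  have "continuous_on K (\<lambda>q. qp q q)"
    using K holomorphic_on_imp_continuous_on[OF holomorphic_on_qp_self] continuous_on_subset by blast
  then have "bounded ((\<lambda>q. qp q q) ` K)" using K compact_continuous_image compact_imp_bounded by blast
  then obtain M where M: "M > 0" "\<And>q. q \<in> K \<Longrightarrow> norm (qp q q) \<le> M" by (auto simp: bounded_pos)
  show ?thesis
  proof (rule that)
    show "M ^ 24 \<ge> 0" using M by simp
    fix z assume z: "Im z \<ge> 1"
    then have "ee z \<in> K" by (simp add: K_def norm_ee)
    then have "norm (qp (ee z) (ee z) ^ 24) \<le> M ^ 24" unfolding norm_power by (intro power_mono M) auto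
    then show "norm (Delta z) \<le> M ^ 24 * exp (- 2 * pi * Im z)"
      using z by (simp add: Delta_eq norm_mult norm_ee mult.commute mult_right_mono)
  qed
qed

text \<open>\<open>T\<^sub>2 \<Delta> / \<Delta>\<close> is a holomorphic function \<open>G\<close> of \<open>h = exp (\<pi> i z)\<close> on the unit disc. The
  inversion \<open>z \<mapsto> - 1 / z\<close> maps points of the strip with \<open>Im z = 1/2\<close> strictly upwards, so
  the maximum of \<open>\<bar>G\<bar>\<close> over the disc \<open>Im z \<ge> 1/2\<close> is attained in its interior.\<close>
theorem Delta_Hecke_2:
  assumes z: "Im z > 0"
  shows "2 ^ 11 * Delta (2 * z) + (Delta (z / 2) + Delta ((z + 1) / 2)) / 2 = - 24 * Delta z"
proof -
  define P where "P = (\<lambda>q. qp q q ^ 24)"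
  define N where "N = (\<lambda>z. 2 ^ 11 * Delta (2 * z) + (Delta (z / 2) + Delta ((z + 1) / 2)) / 2)"
  have N1: "N (z + 1) = N z" if "Im z > 0" for z
  proof -
    have "Delta (2 * (z + 1)) = Delta (2 * z)"
      using Delta_add_int[of "2 * z" 2] that by (simp add: algebra_simps)
    moreover have "Delta ((z + 1 + 1) / 2) = Delta (z / 2)"
      using Delta_add_1[of "z / 2"] that by (simp add: add_divide_distrib add.commute)
    ultimately show ?thesis by (simp add: N_def)
  qed
  have NS: "N (- 1 / z) = z ^ 12 * N z" if z: "Im z > 0" for z
  proof -
    have z0: "z \<noteq> 0" using z by auto
    have 1: "Delta (2 * (- 1 / z)) = (z / 2) ^ 12 * Delta (z / 2)"
      using Delta_inversion[of "z / 2"] z by simp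
    have 2: "Delta (- 1 / z / 2) = (2 * z) ^ 12 * Delta (2 * z)"
      using Delta_inversion[of "2 * z"] z by (simp add: mult.commute)
    \<comment> \<open>Inversion swaps the terms at 2 z and z / 2 and preserves the third up to this
      matrix of determinant 1.\<close>
    have "mob 1 (- 1) 2 (- 1) ((z + 1) / 2) = (- 1 / z + 1) / 2"
      using z0 by (simp add: mob_def field_simps)
    moreover have "of_int 2 * ((z + 1) / 2) + of_int (- 1) = z" by (simp add: field_simps)
    ultimately have 3: "Delta ((- 1 / z + 1) / 2) = z ^ 12 * Delta ((z + 1) / 2)"
      using Delta_mob[of 1 "-1" "-1" 2 "(z + 1) / 2"] z by (simp only:) simp
    show ?thesis unfolding N_def 1 2 3 by (simp add: field_simps)
  qed
  define F where "F = (\<lambda>z. N z / Delta z)"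
  have F1: "F (z + of_int n) = F z" if "Im z > 0" for z n
  proof -
    have "F (z + 1) = F z" if "Im z > 0" for z using that N1 Delta_add_1 by (simp add: F_def)
    note * = this
    show ?thesis
    proof (induction n rule: int_induct[of _ 0])
      case (step1 i) then show ?case using *[of "z + of_int i"] that by (simp add: add_ac)
    next
      case (step2 i) then show ?case using *[of "z + of_int (i - 1)"] that by simp
    qed simp
  qed
  have FS: "F (- 1 / z) = F z" if "Im z > 0" for z
    using NS[OF that] Delta_inversion[OF that] that by (auto simp: F_def)

  \<comment> \<open>The two half-argument terms combine to h P(h) - h P(-h) = h k(h), divisible by
    h^2. Below, \<open>s\<close> is k(h) / h with its singularity filled, so \<open>G\<close>
    extends over the cusp h = 0.\<close>
  define k where "k = (\<lambda>h. P h - P (- h))"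
  have P: "P holomorphic_on ball 0 1"
    unfolding P_def by (intro holomorphic_intros holomorphic_on_qp_self)
  have Pc: "(\<lambda>h. P (f h)) holomorphic_on ball 0 1"
    if "f holomorphic_on ball 0 1" "\<And>h. norm h < 1 \<Longrightarrow> norm (f h) < 1" for f
  proof -
    have "f ` ball 0 1 \<subseteq> ball 0 1" using that(2) by auto
    then show ?thesis using holomorphic_on_compose_gen[OF that(1) P] by (simp add: o_def)
  qed
  have k: "k holomorphic_on ball 0 1"
    unfolding k_def by (intro holomorphic_on_diff Pc holomorphic_intros) auto
  have P': "(P has_field_derivative - 24) (at 0)"
    unfolding P_def by (rule derivative_eq_intros deriv_qp_self_0 refl | simp)+
  have "(k has_field_derivative - 48) (at 0)"
  proof -
    have "((\<lambda>h. P (- h)) has_field_derivative (- 24) * (- 1)) (at 0)"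
      by (rule DERIV_chain2[where f = P and g = uminus]) (use P' in \<open>auto intro!: derivative_eq_intros\<close>)
    then show ?thesis unfolding k_def using DERIV_diff[OF P'] by fastforce
  qed
  then have k': "deriv k 0 = - 48" by (rule DERIV_imp_deriv)
  have k0: "k 0 = 0" by (simp add: k_def)
  define s where "s = (\<lambda>h. if h = 0 then deriv k 0 else (k h - k 0) / (h - 0))"
  have s: "s holomorphic_on ball 0 1"
    unfolding s_def by (rule pole_lemma_open[OF k open_ball])
  define G where "G = (\<lambda>h. (2 ^ 11 * h\<^sup>2 * P (h ^ 4) + s h / 2) / P (h\<^sup>2))"
  have sq: "norm (h ^ n) < 1" if "norm h < 1" "n > 0" for h :: complex and n
    using that by (simp add: norm_power power_less_one_iff)
  have Pnz: "P q \<noteq> 0" if "norm q < 1" for q using qp_self_nonzero[OF that] by (simp add: P_def)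
  have G: "G holomorphic_on ball 0 1"
    unfolding G_def by (intro holomorphic_intros Pc s) (use sq Pnz in auto)
  have FG: "F z = G (ee (z / 2))" if z: "Im z > 0" for z
  proof -
    define h where "h = ee (z / 2)"
    have h: "h \<noteq> 0" "norm h < 1" using z by (auto simp: h_def intro: norm_ee_less_1)
    have "ee z = h\<^sup>2" using ee_double[of "z/2"] by (simp add: h_def)
    moreover have "ee (2 * z) = h ^ 4" unfolding ee_double calculation by simp
    moreover have "ee ((z + 1) / 2) = - h" by (simp add: add_divide_distrib ee_add h_def)
    ultimately have "Delta z = h\<^sup>2 * P (h\<^sup>2)" "Delta (2 * z) = h ^ 4 * P (h ^ 4)"
      "Delta ((z + 1) / 2) = - h * P (- h)" "Delta (z / 2) = h * P h"
      using z by (simp_all add: Delta_eq P_def h_def)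
    then have "F z = (2 ^ 11 * (h ^ 4 * P (h ^ 4)) + (h * P h - h * P (- h)) / 2) / (h\<^sup>2 * P (h\<^sup>2))"
      by (simp add: F_def N_def)
    also have "h * P h - h * P (- h) = h\<^sup>2 * s h"
      using h by (simp add: s_def k0, simp add: k_def field_simps power2_eq_square)
    also have "2 ^ 11 * (h ^ 4 * P (h ^ 4)) + h\<^sup>2 * s h / 2 = h\<^sup>2 * (2 ^ 11 * h\<^sup>2 * P (h ^ 4) + s h / 2)"
      by (simp add: power4_eq_xxxx power2_eq_square algebra_simps)
    finally show ?thesis using h by (simp add: G_def h_def[symmetric])
  qed

  \<comment> \<open>The circle of this radius is Im z = 1/2, as |exp(pi i z)| = exp(-pi Im
    z).\<close>
  define \<rho> where "\<rho> = exp (- (pi / 2))"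
  have \<rho>: "0 < \<rho>" "\<rho> < 1" by (simp_all add: \<rho>_def)
  have nh: "norm (ee (z / 2)) = exp (- pi * Im z)" for z by (simp add: norm_ee)
  have "continuous_on (cball 0 \<rho>) (\<lambda>h. norm (G h))"
    using \<rho> holomorphic_on_imp_continuous_on[OF G]
    by (intro continuous_on_norm) (auto intro: continuous_on_subset)
  then obtain \<xi> where \<xi>: "\<xi> \<in> cball 0 \<rho>" "\<And>h. h \<in> cball 0 \<rho> \<Longrightarrow> norm (G h) \<le> norm (G \<xi>)"
    using continuous_attains_sup[of "cball 0 \<rho>" "\<lambda>h. norm (G h)"] \<rho> by auto
  have "\<exists>\<xi>'\<in>ball 0 \<rho>. G \<xi>' = G \<xi>"
  proof (cases "norm \<xi> < \<rho>")
    case False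
    then have n\<xi>: "norm \<xi> = \<rho>" using \<xi> by simp
    then have \<xi>0: "\<xi> \<noteq> 0" using \<rho> by auto
    define z where "z = Ln \<xi> / (pi * \<i>)"
    have ez: "ee (z / 2) = \<xi>" using \<xi>0 by (simp add: ee_def z_def)
    then have "exp (- pi * Im z) = \<rho>" using nh[of z] n\<xi> by simp
    then have Imz: "Im z = 1 / 2" unfolding \<rho>_def by simp
    define n where "n = - round (Re z)"
    define z1 where "z1 = z + of_int n"
    have re: "\<bar>Re z1\<bar> \<le> 1 / 2" using of_int_round_abs_le[of "Re z"] by (simp add: z1_def n_def abs_minus_commute)
    have im: "Im z1 = 1 / 2" by (simp add: z1_def Imz)
    have "(Re z1)\<^sup>2 \<le> (1 / 2)\<^sup>2" using re by (simp add: abs_le_square_iff[symmetric])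
    then have nz1: "(norm z1)\<^sup>2 \<le> 1 / 2" unfolding cmod_power2 im by (simp add: power2_eq_square)
    define z2 where "z2 = - 1 / z1"
    have "z1 \<noteq> 0" using im by auto
    have "Im z2 = (1 / 2) / (norm z1)\<^sup>2"
      using Im_mob[of 0 0 "-1" 1 z1] im by (simp add: z2_def mob_def)
    also have "\<dots> \<ge> 1" using nz1 \<open>z1 \<noteq> 0\<close> by (simp add: field_simps)
    finally have imz2: "Im z2 \<ge> 1" .
    have "F z2 = F z" unfolding z2_def z1_def using F1[of z n] FS[of "z + of_int n"] Imz by simp
    then have "G (ee (z2 / 2)) = G \<xi>" using FG[of z] FG[of z2] Imz imz2 ez by simp
    moreover have "ee (z2 / 2) \<in> ball 0 \<rho>" using nh[of z2] imz2 by (simp add: \<rho>_def)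
    ultimately show ?thesis by blast
  qed (use \<xi> in auto)
  then obtain \<xi>' where \<xi>': "\<xi>' \<in> ball 0 \<rho>" "G \<xi>' = G \<xi>" by blast
  have "G constant_on ball 0 1"
    by (rule maximum_modulus_principle[OF G, of "ball 0 \<rho>" \<xi>']) (use \<xi>' \<xi> \<rho> in auto)
  then obtain y where "\<And>h. h \<in> ball 0 1 \<Longrightarrow> G h = y" unfolding constant_on_def by blast
  then have "G h = G 0" if "norm h < 1" for h using that by simp
  \<comment> \<open>Only \<open>s 0 / 2\<close> survives at 0, and \<open>s 0 = deriv k 0\<close> is
    twice the derivative -24 of \<open>P\<close>.\<close>
  moreover have "G 0 = - 24" by (simp add: G_def s_def k' P_def)
  ultimately have "F z = - 24" using FG[OF z] norm_ee_less_1[of "z / 2"] z by simp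
  then show ?thesis using Delta_nonzero[OF z] by (simp add: F_def N_def field_simps)
qed

section \<open>Limits at cusps\<close>

text \<open>The rate exp(-Im z) is weaker than the true rate of Delta, which leaves room to absorb
  polynomial factors. Bounds on whole strips allow vertical lines to be compared with each
  other.\<close>

definition decays :: "(complex \<Rightarrow> complex) \<Rightarrow> bool" where
  "decays f \<longleftrightarrow> (\<forall>B. \<exists>C. \<forall>z. \<bar>Re z\<bar> \<le> B \<longrightarrow> Im z \<ge> 1 \<longrightarrow> norm (f z) \<le> C * exp (- Im z))"

text \<open>Each Horner step spends half of the exponent on the factor z and half on the remaining
  polynomial, so the induction must hold for every positive rate.\<close>

lemma poly_bound_strip:
  fixes p :: "complex poly"
  assumes "\<delta> > 0"
  shows "\<exists>K\<ge>0. \<forall>z. \<bar>Re z\<bar> \<le> B \<longrightarrow> Im z \<ge> 1 \<longrightarrow> norm (poly p z) \<le> K * exp (\<delta> * Im z)"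
  using assms
proof (induction p arbitrary: \<delta>)
  case 0 then show ?case by auto
next
  case (pCons a p)
  have d2: "\<delta> / 2 > 0" using pCons.prems by simp
  from pCons.IH[OF this] obtain K where K: "K \<ge> 0"
    "\<And>z. \<bar>Re z\<bar> \<le> B \<Longrightarrow> Im z \<ge> 1 \<Longrightarrow> norm (poly p z) \<le> K * exp (\<delta> / 2 * Im z)" by blast
  define M where "M = norm a + (\<bar>B\<bar> + 2 / \<delta>) * K"
  have "norm (poly (pCons a p) z) \<le> M * exp (\<delta> * Im z)" if z: "\<bar>Re z\<bar> \<le> B" "Im z \<ge> 1" for z
  proof -
    define E where "E = exp (\<delta> / 2 * Im z)"
    have E: "E \<ge> 1" "exp (\<delta> * Im z) = E * E"
      using pCons.prems z by (auto simp: E_def simp flip: exp_add)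
    have "Im z * (\<delta> / 2) \<le> E"
      using exp_ge_add_one_self[of "\<delta> / 2 * Im z"] unfolding E_def by (simp only: mult.commute)
    then have "Im z \<le> 2 / \<delta> * E" using pCons.prems by (simp add: field_simps)
    moreover have "\<bar>B\<bar> \<le> \<bar>B\<bar> * E" using E(1) mult_left_mono[of 1 E "\<bar>B\<bar>"] by simp
    moreover have "norm z \<le> \<bar>B\<bar> + Im z" using cmod_le[of z] z by linarith
    ultimately have nz: "norm z \<le> (\<bar>B\<bar> + 2 / \<delta>) * E" by (simp add: distrib_right)
    have EE: "1 \<le> E * E" using E(1) mult_mono[of 1 E 1 E] by simp
    have "norm (poly (pCons a p) z) \<le> norm a + norm z * norm (poly p z)"
      by (simp add: norm_mult[symmetric] norm_triangle_ineq)
    also have "norm z * norm (poly p z) \<le> ((\<bar>B\<bar> + 2 / \<delta>) * E) * (K * E)"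
      using K(2)[OF z] K(1) nz E pCons.prems by (intro mult_mono) (auto simp: E_def)
    also have "norm a \<le> norm a * (E * E)" using EE mult_left_mono[of 1 "E * E" "norm a"] by simp
    finally show ?thesis unfolding E(2) by (simp add: M_def algebra_simps)
  qed
  moreover have "M \<ge> 0" using K(1) pCons.prems by (simp add: M_def)
  ultimately show ?case by blast
qed

lemma decays_Delta_poly: "decays (\<lambda>z. Delta z * poly p z)"
  unfolding decays_def
proof
  fix B :: real
  obtain K where K: "K \<ge> 0" "\<And>z. \<bar>Re z\<bar> \<le> B \<Longrightarrow> Im z \<ge> 1 \<Longrightarrow> norm (poly p z) \<le> K * exp (1 * Im z)"
    using poly_bound_strip[of 1 B p] by auto
  obtain C where C: "C \<ge> 0" "\<And>z. Im z \<ge> 1 \<Longrightarrow> norm (Delta z) \<le> C * exp (- 2 * pi * Im z)"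
    using Delta_bound by blast
  have "norm (Delta z * poly p z) \<le> C * K * exp (- Im z)" if z: "\<bar>Re z\<bar> \<le> B" "Im z \<ge> 1" for z
  proof -
    have "1 * Im z \<le> pi * Im z" using pi_gt3 z by (intro mult_right_mono) auto
    then have e: "exp (- 2 * pi * Im z) * exp (1 * Im z) \<le> exp (- Im z)"
      by (simp flip: exp_add)
    have "norm (Delta z * poly p z) \<le> (C * exp (- 2 * pi * Im z)) * (K * exp (1 * Im z))"
      unfolding norm_mult using C K z by (intro mult_mono) auto
    also have "\<dots> = C * K * (exp (- 2 * pi * Im z) * exp (1 * Im z))" by (simp only: mult_ac)
    also have "\<dots> \<le> C * K * exp (- Im z)" using e C K by (intro mult_left_mono) auto
    finally show ?thesis .
  qed
  then show "\<exists>C. \<forall>z. \<bar>Re z\<bar> \<le> B \<longrightarrow> Im z \<ge> 1 \<longrightarrow> norm (Delta z * poly p z) \<le> C * exp (- Im z)" by blast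
qed

lemma Complex_vector_derivative:
  "((\<lambda>y. Complex x y) has_vector_derivative \<i>) (at y)"
proof -
  have "((\<lambda>y. complex_of_real x + complex_of_real y * \<i>) has_vector_derivative \<i>) (at y)"
    by (rule derivative_eq_intros | simp)+
  then show ?thesis by (simp add: complex_eq_iff[THEN iffD2] Complex_eq mult.commute)
qed

text \<open>Integrable decay gives a Cauchy limit on the imaginary axis. A horizontal segment at
  height y changes F by at most C |x| exp(-y), so the limit is the same on all vertical lines, as
  \<open>climit\<close> requires.\<close>

lemma decays_primitive_limit:
  assumes F: "\<And>z. Im z > 0 \<Longrightarrow> (F has_field_derivative f z) (at z)"
    and f: "decays f"
  shows "\<exists>L. \<forall>x. ((\<lambda>y. F (Complex x y)) \<longlongrightarrow> L) at_top"
proof -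
  have mono: "norm (F (Complex 0 b) - F (Complex 0 a)) \<le> C * exp (- a)"
    if C: "\<And>z. \<bar>Re z\<bar> \<le> 0 \<Longrightarrow> Im z \<ge> 1 \<Longrightarrow> norm (f z) \<le> C * exp (- Im z)" and ab: "1 \<le> a" "a < b" for a b C
  proof -
    have d: "((\<lambda>y. F (Complex 0 y)) has_vector_derivative \<i> * f (Complex 0 y)) (at y)" if "y > 0" for y
      using field_vector_diff_chain_at[OF Complex_vector_derivative[of 0 y] F[of "Complex 0 y"]] that
      by (simp add: o_def mult.commute)
    have "C \<ge> 0" using C[of \<i>] norm_ge_zero[of "f \<i>"]
      by (metis (no_types, opaque_lifting) exp_gt_zero imaginary_unit.sel(1) imaginary_unit.sel(2) abs_zero order.refl
          order_trans zero_le_mult_iff linorder_not_less)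
    \<comment> \<open>The comparison function - C exp(-y) is a primitive of the bound on the
      derivative.\<close>
    have "norm (F (Complex 0 b) - F (Complex 0 a)) \<le> (- C * exp (- b)) - (- C * exp (- a))"
    proof (rule differentiable_bound_general[OF ab(2)])
      show "continuous_on {a..b} (\<lambda>y. F (Complex 0 y))"
        using ab d by (intro continuous_at_imp_continuous_on ballI has_vector_derivative_continuous) (use ab in \<open>auto intro!: d\<close>)
      show "continuous_on {a..b} (\<lambda>y. - C * exp (- y))" by (intro continuous_intros)
      show "((\<lambda>y. F (Complex 0 y)) has_vector_derivative \<i> * f (Complex 0 y)) (at y)" if "a < y" "y < b" for y
        using d ab that by simp
      show "((\<lambda>y. - C * exp (- y)) has_vector_derivative C * exp (- y)) (at y)" if "a < y" "y < b" for y
        by (auto intro!: derivative_eq_intros simp: has_real_derivative_iff_has_vector_derivative[symmetric])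
      show "norm (\<i> * f (Complex 0 y)) \<le> C * exp (- y)" if "a < y" "y < b" for y
        using C[of "Complex 0 y"] that ab by (simp add: norm_mult)
    qed
    then show ?thesis using mult_nonneg_nonneg[OF \<open>C \<ge> 0\<close>, of "exp (- b)"] by simp
  qed
  from f obtain C0 where C0: "\<And>z. \<bar>Re z\<bar> \<le> 0 \<Longrightarrow> Im z \<ge> 1 \<Longrightarrow> norm (f z) \<le> C0 * exp (- Im z)"
    unfolding decays_def by blast
  have lim0: "((\<lambda>y. C * exp (- y)) \<longlongrightarrow> 0) at_top" for C :: real
    using tendsto_mult_right_zero[OF filterlim_compose[OF exp_at_bot filterlim_uminus_at_bot_at_top], of C] by simp
  have "Cauchy (\<lambda>n. F (Complex 0 (real n)))"
  proof (rule CauchyI')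
    fix e :: real assume "e > 0"
    then have "eventually (\<lambda>y. \<bar>C0 * exp (- y)\<bar> < e) at_top"
      using lim0[of C0] by (simp add: tendsto_iff dist_real_def)
    then have "eventually (\<lambda>y. \<bar>C0 * exp (- y)\<bar> < e \<and> y \<ge> 1) at_top"
      using eventually_ge_at_top[of 1] by eventually_elim auto
    then obtain M where M: "\<And>y. y \<ge> M \<Longrightarrow> \<bar>C0 * exp (- y)\<bar> < e \<and> y \<ge> 1" by (auto simp: eventually_at_top_linorder)
    show "\<exists>M. \<forall>m\<ge>M. \<forall>n>m. dist (F (Complex 0 (real m))) (F (Complex 0 (real n))) < e"
    proof (intro exI allI impI)
      fix m n :: nat assume mn: "nat \<lceil>M\<rceil> \<le> m" "m < n"
      then have "real m \<ge> M" by linarith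
      then have m: "\<bar>C0 * exp (- real m)\<bar> < e" "1 \<le> real m" using M[of "real m"] by auto
      then show "dist (F (Complex 0 (real m))) (F (Complex 0 (real n))) < e"
        using mono[OF C0 m(2), of "real n"] mn by (simp add: dist_norm norm_minus_commute)
    qed
  qed
  then obtain L where L: "(\<lambda>n. F (Complex 0 (real n))) \<longlonglongrightarrow> L"
    using Cauchy_convergent convergent_def by blast
  have bL: "norm (L - F (Complex 0 y)) \<le> C0 * exp (- y)" if "y \<ge> 1" for y
  proof (rule Lim_norm_ubound)
    show "(\<lambda>n. F (Complex 0 (real n)) - F (Complex 0 y)) \<longlonglongrightarrow> L - F (Complex 0 y)"
      by (intro tendsto_intros L)
    have "eventually (\<lambda>n. real n > y) sequentially"
      using eventually_gt_at_top filterlim_real_sequentially unfolding filterlim_def le_filter_def eventually_filtermap by blast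
    then show "\<forall>\<^sub>F n in sequentially. norm (F (Complex 0 (real n)) - F (Complex 0 y)) \<le> C0 * exp (- y)"
      by eventually_elim (use mono[OF C0 that] in auto)
  qed simp
  have "((\<lambda>y. F (Complex x y)) \<longlongrightarrow> L) at_top" for x
  proof -
    from f obtain C where C: "\<And>z. \<bar>Re z\<bar> \<le> \<bar>x\<bar> \<Longrightarrow> Im z \<ge> 1 \<Longrightarrow> norm (f z) \<le> C * exp (- Im z)"
      unfolding decays_def by blast
    have bx: "norm (F (Complex x y) - F (Complex 0 y)) \<le> C * exp (- y) * \<bar>x\<bar>" if y: "y \<ge> 1" for y
    proof -
      define S where "S = closed_segment (Complex 0 y) (Complex x y)"
      have S: "Im z = y \<and> \<bar>Re z\<bar> \<le> \<bar>x\<bar>" if z: "z \<in> S" for z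
      proof -
        obtain u where u: "0 \<le> u" "u \<le> 1" "z = (1 - u) *\<^sub>R Complex 0 y + u *\<^sub>R Complex x y"
          using z by (auto simp: S_def in_segment)
        then have "Im z = y" "Re z = u * x" unfolding u(3) by (simp_all add: left_diff_distrib)
        moreover have "\<bar>u * x\<bar> \<le> 1 * \<bar>x\<bar>" unfolding abs_mult using u by (intro mult_right_mono) auto
        ultimately show ?thesis by simp
      qed
      have "norm (F (Complex x y) - F (Complex 0 y)) \<le> C * exp (- y) * norm (Complex x y - Complex 0 y)"
      proof (rule field_differentiable_bound)
        show "convex S" by (simp add: S_def)
        show "(F has_field_derivative f z) (at z within S)" if "z \<in> S" for z
          using F[of z] S[OF that] y by (auto intro: has_field_derivative_at_within)
        show "norm (f z) \<le> C * exp (- y)" if "z \<in> S" for z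
          using C[of z] S[OF that] y by auto
      qed (auto simp: S_def)
      also have "norm (Complex x y - Complex 0 y) = \<bar>x\<bar>" by (simp add: cmod_def)
      finally show ?thesis .
    qed
    have "((\<lambda>y. F (Complex x y) - L) \<longlongrightarrow> 0) at_top"
    proof (rule Lim_null_comparison)
      show "((\<lambda>y. (C * \<bar>x\<bar> + C0) * exp (- y)) \<longlongrightarrow> 0) at_top" by (rule lim0)
      show "\<forall>\<^sub>F y in at_top. norm (F (Complex x y) - L) \<le> (C * \<bar>x\<bar> + C0) * exp (- y)"
        using eventually_ge_at_top[of 1]
      proof eventually_elim
        case (elim y)
        have "F (Complex x y) - L = (F (Complex x y) - F (Complex 0 y)) - (L - F (Complex 0 y))" by simp
        then have "norm (F (Complex x y) - L) \<le> norm (F (Complex x y) - F (Complex 0 y)) + norm (L - F (Complex 0 y))"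
          using norm_triangle_ineq4 by metis
        then show ?case using bx[OF elim] bL[OF elim] by (simp add: algebra_simps)
      qed
    qed
    then show ?thesis by (rule LIM_zero_cancel)
  qed
  then show ?thesis by blast
qed

section \<open>Cusps in homogeneous integer coordinates\<close>

definition cusp_of :: "int \<Rightarrow> int \<Rightarrow> cusp" where
  "cusp_of x y = (if y = 0 then Inf else Fin (of_int x / of_int y))"

lemma cusp_cases:
  obtains x y where "coprime x y" "r = cusp_of x y"
proof (cases r)
  case (Fin q)
  obtain x y where xy: "quotient_of q = (x, y)" by (cases "quotient_of q")
  then show ?thesis
    using Fin quotient_of_coprime[OF xy] quotient_of_denom_pos[OF xy] quotient_of_div[OF xy]
    by (intro that[of x y]) (auto simp: cusp_of_def)
next
  case Inf then show ?thesis using that[of 1 0] by (simp add: cusp_of_def)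
qed

text \<open>Zero vectors must be excluded because \<open>cusp_of 0 0\<close> is \<open>Inf\<close>
  by default, while the cross product with a zero vector always vanishes.\<close>

lemma cusp_of_eq_iff:
  assumes "x \<noteq> 0 \<or> y \<noteq> 0" "x' \<noteq> 0 \<or> y' \<noteq> 0"
  shows "cusp_of x y = cusp_of x' y' \<longleftrightarrow> x * y' = x' * y"
proof -
  have "of_int x / of_int y = (of_int x' / of_int y' :: rat) \<longleftrightarrow> x * y' = x' * y" if "y \<noteq> 0" "y' \<noteq> 0"
  proof -
    have "of_int x / of_int y = (of_int x' / of_int y' :: rat) \<longleftrightarrow> (of_int (x * y') :: rat) = of_int (x' * y)"
      using that by (simp add: field_simps)
    then show ?thesis unfolding of_int_eq_iff .
  qed
  then show ?thesis using assms by (auto simp: cusp_of_def)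
qed

lemma moebius_Inf: "moebius a b c d Inf = cusp_of a c"
  by (simp add: cusp_of_def)

lemma moebius_cusp_of:
  assumes "a * d - b * c = 1" "x \<noteq> 0 \<or> y \<noteq> 0"
  shows "moebius a b c d (cusp_of x y) = cusp_of (a * x + b * y) (c * x + d * y)"
proof (cases "y = 0")
  case True
  then have "x \<noteq> 0" using assms by simp
  show ?thesis using True \<open>x \<noteq> 0\<close> by (simp add: cusp_of_def)
next
  case False
  have 1: "of_int c * (of_int x / of_int y) + of_int d = (of_int (c * x + d * y) / of_int y :: rat)"
    and 2: "of_int a * (of_int x / of_int y) + of_int b = (of_int (a * x + b * y) / of_int y :: rat)"
    using False by (simp_all add: field_simps)
  have "moebius a b c d (cusp_of x y) = (if of_int (c * x + d * y) / of_int y = (0 :: rat) then Inf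
      else Fin ((of_int (a * x + b * y) / of_int y) / (of_int (c * x + d * y) / of_int y)))"
    using False unfolding cusp_of_def by (simp only: if_False moebius.simps 1 2)
  then show ?thesis using False unfolding cusp_of_def by (simp del: of_int_add of_int_mult)
qed

lemma moebius_vector_nonzero:
  fixes a b c d x y :: int
  assumes "a * d - b * c = 1" "x \<noteq> 0 \<or> y \<noteq> 0"
  shows "a * x + b * y \<noteq> 0 \<or> c * x + d * y \<noteq> 0"
proof (rule ccontr)
  assume "\<not> ?thesis"
  then have *: "a * x + b * y = 0" "c * x + d * y = 0" by auto
  have "(a * d - b * c) * x = d * (a * x + b * y) - b * (c * x + d * y)"
    and "(a * d - b * c) * y = a * (c * x + d * y) - c * (a * x + b * y)"
    by (simp_all add: algebra_simps)
  then show False using assms unfolding * by simp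
qed

lemma moebius_inverse:
  assumes "a * d - b * c = 1"
  shows "moebius d (- b) (- c) a (moebius a b c d r) = r"
proof -
  obtain x y where r: "coprime x y" "r = cusp_of x y" by (rule cusp_cases)
  have xy: "x \<noteq> 0 \<or> y \<noteq> 0" using r(1) by auto
  have det': "d * a - (- b) * (- c) = 1" using assms by (simp add: mult.commute)
  have "d * (a * x + b * y) + (- b) * (c * x + d * y) = (a * d - b * c) * x"
    "(- c) * (a * x + b * y) + a * (c * x + d * y) = (a * d - b * c) * y"
    by (simp_all add: algebra_simps)
  then show ?thesis
    unfolding r(2) moebius_cusp_of[OF assms xy] moebius_cusp_of[OF det' moebius_vector_nonzero[OF assms xy]] assms
    by simp
qed

lemma moebius_matrix_exists:
  obtains a b c d where "a * d - b * c = 1" "moebius a b c d Inf = r"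
proof -
  obtain x y where r: "coprime x y" "r = cusp_of x y" by (rule cusp_cases)
  obtain u v where "u * x + v * y = 1" using bezout_int[of x y] r(1) by auto
  then have "x * u - (- v) * y = 1" by (simp add: mult.commute)
  moreover have "moebius x (- v) y u Inf = r" unfolding moebius_Inf r(2) ..
  ultimately show ?thesis by (rule that)
qed

text \<open>The geodesics ending at \<open>r = g \<infinity>\<close> are the images under \<open>g\<close> of the vertical lines. Quantifying
  over all \<open>g\<close> makes this notion manifestly equivariant.\<close>
definition climit :: "(complex \<Rightarrow> complex) \<Rightarrow> cusp \<Rightarrow> complex \<Rightarrow> bool" where
  "climit F r L \<longleftrightarrow> (\<forall>a b c d x. a * d - b * c = 1 \<longrightarrow> moebius a b c d Inf = r \<longrightarrow>
     ((\<lambda>y. F (mob a b c d (Complex x y))) \<longlongrightarrow> L) at_top)"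

lemma climit_moebius:
  assumes g: "a * d - b * c = 1" and lim: "climit (\<lambda>z. F (mob a b c d z)) s L"
  shows "climit F (moebius a b c d s) L"
  unfolding climit_def
proof (intro allI impI)
  fix a' b' c' d' x
  assume h: "a' * d' - b' * c' = 1" and hs: "moebius a' b' c' d' Inf = moebius a b c d s"
  have g': "d * a - (- b) * (- c) = 1" using g by (simp add: mult.commute)
  \<comment> \<open>Entries of the inverse of the first matrix times the second.\<close>
  define A B C D where "A = d * a' - b * c'" and "B = d * b' - b * d'" and "C = a * c' - c * a'" and "D = a * d' - c * b'"
  have "A * D - B * C = (a * d - b * c) * (a' * d' - b' * c')"
    by (simp add: A_def B_def C_def D_def algebra_simps)
  then have det: "A * D - B * C = 1" using g h by simp
  have ac': "a' \<noteq> 0 \<or> c' \<noteq> 0" using h by auto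
  have hs': "cusp_of a' c' = moebius a b c d s" using hs unfolding moebius_Inf .
  have "s = moebius d (- b) (- c) a (cusp_of a' c')"
    unfolding hs' moebius_inverse[OF g] ..
  also have "\<dots> = moebius A B C D Inf"
    unfolding moebius_cusp_of[OF g' ac'] moebius_Inf A_def C_def by (simp add: algebra_simps)
  finally have l: "((\<lambda>y. F (mob a b c d (mob A B C D (Complex x y)))) \<longlongrightarrow> L) at_top"
    using lim det unfolding climit_def by auto
  have "a * A + b * C = (a * d - b * c) * a'" "a * B + b * D = (a * d - b * c) * b'"
    "c * A + d * C = (a * d - b * c) * c'" "c * B + d * D = (a * d - b * c) * d'"
    by (simp_all add: A_def B_def C_def D_def algebra_simps)
  then have e: "mob a b c d (mob A B C D (Complex x y)) = mob a' b' c' d' (Complex x y)" if "y > 0" for y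
    using mob_compose[OF det _ g, of "Complex x y"] that g by simp
  have "\<forall>\<^sub>F y in at_top. F (mob a b c d (mob A B C D (Complex x y))) = F (mob a' b' c' d' (Complex x y))"
    using eventually_gt_at_top[of 0] by eventually_elim (simp add: e)
  then show "((\<lambda>y. F (mob a' b' c' d' (Complex x y))) \<longlongrightarrow> L) at_top"
    using l by (rule Lim_transform_eventually[rotated])
qed

lemma climit_Inf:
  assumes "\<And>x. ((\<lambda>y. F (Complex x y)) \<longlongrightarrow> L) at_top"
  shows "climit F Inf L"
  unfolding climit_def
proof (intro allI impI)
  fix a b c d x assume det: "a * d - b * c = 1" and "moebius a b c d Inf = Inf"
  then have c: "c = 0" by (auto split: if_splits)
  then have "a * d = 1" using det by simp
  then have "a = 1 \<and> d = 1 \<or> a = -1 \<and> d = -1" using pos_zmult_eq_1_iff_lemma zmult_eq_1_iff by blast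
  then have "mob a b c d (Complex x y) = Complex (x + of_int (a * b)) y" for y
    by (auto simp: mob_def c complex_eq_iff)
  then show "((\<lambda>y. F (mob a b c d (Complex x y))) \<longlongrightarrow> L) at_top" using assms by simp
qed

lemma climit_Inf_D:
  assumes "climit F Inf L" shows "((\<lambda>y. F (Complex x y)) \<longlongrightarrow> L) at_top"
proof -
  have "((\<lambda>y. F (mob 1 0 0 1 (Complex x y))) \<longlongrightarrow> L) at_top"
    using assms unfolding climit_def by (metis diff_zero moebius.simps(1) mult_1 mult_zero_left)
  then show ?thesis by (simp add: mob_def)
qed

text \<open>In the coordinate w = - 1 / (z - r) the geodesics ending at r are the lines Re w = u.
  The value u = 0 is the vertical line at r; for a semicircle of radius rho, u is 1 / (2 rho) at its
  right end and - 1 / (2 rho) at its left end.\<close>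

lemma climit_Fin_D:
  assumes "climit F (Fin r) L"
  shows "((\<lambda>v. F (of_rat r - 1 / Complex u v)) \<longlongrightarrow> L) at_top"
proof -
  obtain a b c d where m: "a * d - b * c = 1" "moebius a b c d Inf = Fin r" by (rule moebius_matrix_exists)
  then have c: "c \<noteq> 0" and r: "r = of_int a / of_int c" by (auto split: if_splits)
  \<comment> \<open>Chosen so that c (c z + d) has real part u: c^2 x + c d = u.\<close>
  define x where "x = (u - of_int c * of_int d) / (of_int c)\<^sup>2"
  have l: "((\<lambda>y. F (mob a b c d (Complex x y))) \<longlongrightarrow> L) at_top" using assms m unfolding climit_def by blast
  have "filterlim (\<lambda>v::real. (1 / (of_int c)\<^sup>2) * v) at_top at_top"
    using c by (intro filterlim_tendsto_pos_mult_at_top[OF tendsto_const] filterlim_ident) auto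
  from filterlim_compose[OF l this]
  have l2: "((\<lambda>v. F (mob a b c d (Complex x (1 / (of_int c)\<^sup>2 * v)))) \<longlongrightarrow> L) at_top" .
  have e: "mob a b c d (Complex x (1 / (of_int c)\<^sup>2 * v)) = of_rat r - 1 / Complex u v" if "v > 0" for v
  proof -
    define z where "z = Complex x (1 / (of_int c)\<^sup>2 * v)"
    have z: "Im z > 0" using that c by (simp add: z_def)
    have cz: "of_int c * (of_int c * z + of_int d) = Complex u v"
      using c by (simp add: z_def x_def complex_eq_iff field_simps power2_eq_square)
    have nz: "of_int c * z + of_int d \<noteq> 0" by (rule mob_denom_nonzero[OF m(1) z])
    have ad: "of_int a * of_int d - of_int b * of_int c = (1 :: complex)"
      using m(1) by (metis of_int_1 of_int_diff of_int_mult)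
    have "mob a b c d z = of_int a / of_int c - (of_int a * of_int d - of_int b * of_int c) / (of_int c * (of_int c * z + of_int d))"
      using nz c by (simp add: mob_def divide_simps) (simp add: algebra_simps)
    then have "mob a b c d z = of_int a / of_int c - 1 / Complex u v" unfolding cz ad .
    then show ?thesis by (simp add: z_def r of_rat_divide)
  qed
  have "\<forall>\<^sub>F v in at_top. F (mob a b c d (Complex x (1 / (of_int c)\<^sup>2 * v))) = F (of_rat r - 1 / Complex u v)"
    using eventually_gt_at_top[of 0] by eventually_elim (simp only: e)
  then show ?thesis by (rule Lim_transform_eventually[OF l2])
qed

lemma climit_cong:
  assumes "\<And>z. Im z > 0 \<Longrightarrow> F z = G z"
  shows "climit F r L \<longleftrightarrow> climit G r L"
proof -
  have "((\<lambda>y. F (mob a b c d (Complex x y))) \<longlongrightarrow> L) at_top \<longleftrightarrow> ((\<lambda>y. G (mob a b c d (Complex x y))) \<longlongrightarrow> L) at_top"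
    if "a * d - b * c = 1" for a b c d x
    by (intro filterlim_cong refl eventually_mono[OF eventually_gt_at_top[of 0]] assms Im_mob_pos that) auto
  then show ?thesis unfolding climit_def by blast
qed

lemma climit_const: "climit (\<lambda>z. k) r k"
  by (simp add: climit_def)

lemma climit_add: "climit F r L \<Longrightarrow> climit G r M \<Longrightarrow> climit (\<lambda>z. F z + G z) r (L + M)"
  unfolding climit_def by (intro allI impI tendsto_add) blast+

lemma climit_mult_left: "climit F r L \<Longrightarrow> climit (\<lambda>z. k * F z) r (k * L)"
  unfolding climit_def by (intro allI impI tendsto_mult_left) blast

lemma climit_sum: "(\<And>i. i \<in> I \<Longrightarrow> climit (F i) r (L i)) \<Longrightarrow> climit (\<lambda>z. \<Sum>i\<in>I. F i z) r (\<Sum>i\<in>I. L i)"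
  unfolding climit_def by (intro allI impI tendsto_sum) blast

lemma climit_unique:
  assumes "climit F r L" "climit F r M" shows "L = M"
proof -
  obtain a b c d where m: "a * d - b * c = 1" "moebius a b c d Inf = r" by (rule moebius_matrix_exists)
  then have "((\<lambda>y. F (mob a b c d (Complex 0 y))) \<longlongrightarrow> L) at_top" "((\<lambda>y. F (mob a b c d (Complex 0 y))) \<longlongrightarrow> M) at_top"
    using assms unfolding climit_def by blast+
  then show ?thesis by (rule tendsto_unique[rotated]) simp
qed

section \<open>Primitives of Delta times a polynomial\<close>

lemma mob_has_field_derivative:
  assumes "a * d - b * c = 1" "Im z > 0"
  shows "(mob a b c d has_field_derivative 1 / (of_int c * z + of_int d)\<^sup>2) (at z)"
proof -
  have nz: "of_int c * z + of_int d \<noteq> 0" by (rule mob_denom_nonzero[OF assms])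
  have ad: "of_int a * of_int d - of_int b * of_int c = (1 :: complex)"
    using assms(1) by (metis of_int_1 of_int_diff of_int_mult)
  have "(mob a b c d has_field_derivative (of_int a * (of_int c * z + of_int d) - (of_int a * z + of_int b) * of_int c)
      / ((of_int c * z + of_int d) * (of_int c * z + of_int d))) (at z)"
    unfolding mob_def[abs_def] using nz by (auto intro!: derivative_eq_intros)
  also have "of_int a * (of_int c * z + of_int d) - (of_int a * z + of_int b) * of_int c = 1"
    unfolding ad[symmetric] by (simp add: algebra_simps)
  finally show ?thesis by (simp add: power2_eq_square)
qed

text \<open>Weight 12 of Delta against the factor (c z + d)^(-2) from the derivative leaves the
  exponent 10, the degree of the coefficient module.\<close>

lemma primitive_mob:
  assumes F: "\<And>z. Im z > 0 \<Longrightarrow> (F has_field_derivative Delta z * \<phi> z) (at z)"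
    and g: "a * d - b * c = 1" and z: "Im z > 0"
  shows "((\<lambda>z. F (mob a b c d z)) has_field_derivative
     Delta z * ((of_int c * z + of_int d) ^ 10 * \<phi> (mob a b c d z))) (at z)"
proof -
  have nz: "of_int c * z + of_int d \<noteq> 0" by (rule mob_denom_nonzero[OF g z])
  have "((\<lambda>z. F (mob a b c d z)) has_field_derivative
     (Delta (mob a b c d z) * \<phi> (mob a b c d z)) * (1 / (of_int c * z + of_int d)\<^sup>2)) (at z)"
    by (rule DERIV_chain2[OF F mob_has_field_derivative]) (use g z Im_mob_pos[OF g z] in auto)
  also have "(Delta (mob a b c d z) * \<phi> (mob a b c d z)) * (1 / (of_int c * z + of_int d)\<^sup>2)
      = Delta z * ((of_int c * z + of_int d) ^ 10 * \<phi> (mob a b c d z))"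
  proof -
    have e: "(of_int c * z + of_int d) ^ 10 = (of_int c * z + of_int d) ^ 12 / (of_int c * z + of_int d)\<^sup>2"
      using power_diff[OF nz, of 2 12] by simp
    show ?thesis unfolding Delta_mob[OF g z] e by simp
  qed
  finally show ?thesis .
qed

lemma primitive_climit_exists:
  assumes F: "\<And>z. Im z > 0 \<Longrightarrow> (F has_field_derivative Delta z * z ^ j) (at z)" and j: "j \<le> 10"
  shows "\<exists>L. climit F r L"
proof -
  obtain a b c d where m: "a * d - b * c = 1" "moebius a b c d Inf = r" by (rule moebius_matrix_exists)
  \<comment> \<open>Since j <= 10, the automorphy factor clears the denominator of
    \<open>mob a b c d z ^ j\<close>, so the decay bound for polynomial multiples of Delta
    applies.\<close>
  define p :: "complex poly" where "p = [:of_int b, of_int a:] ^ j * [:of_int d, of_int c:] ^ (10 - j)"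
  have p: "poly p z = (of_int c * z + of_int d) ^ 10 * mob a b c d z ^ j" if z: "Im z > 0" for z
  proof -
    have nz: "of_int c * z + of_int d \<noteq> 0" by (rule mob_denom_nonzero[OF m(1) z])
    have "(of_int c * z + of_int d) ^ 10 = (of_int c * z + of_int d) ^ j * (of_int c * z + of_int d) ^ (10 - j)"
      using j by (simp flip: power_add)
    then show ?thesis using nz by (simp add: p_def poly_power mob_def power_divide add.commute mult.commute)
  qed
  have "((\<lambda>z. F (mob a b c d z)) has_field_derivative Delta z * poly p z) (at z)" if "Im z > 0" for z
    using primitive_mob[OF F m(1) that] p[OF that] by simp
  then obtain L where "\<And>x. ((\<lambda>y. F (mob a b c d (Complex x y))) \<longlongrightarrow> L) at_top"
    using decays_primitive_limit[OF _ decays_Delta_poly[of p], of "\<lambda>z. F (mob a b c d z)"] by auto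
  then have "climit (\<lambda>z. F (mob a b c d z)) Inf L" by (rule climit_Inf)
  then show ?thesis using climit_moebius[OF m(1)] m(2) by blast
qed

text \<open>The two ends need different treatments: near 0 only a limit of the primitive is
  available, while at infinity the bound on g makes dominated convergence of truncations
  possible.\<close>

lemma has_integral_Ioi:
  fixes G g :: "real \<Rightarrow> complex"
  assumes G: "\<And>t. t > 0 \<Longrightarrow> (G has_vector_derivative g t) (at t)"
    and A: "(G \<longlongrightarrow> A) (at_right 0)" and B: "(G \<longlongrightarrow> B) at_top"
    and g: "\<And>t. t \<ge> 1 \<Longrightarrow> norm (g t) \<le> C * exp (- t)"
  shows "(g has_integral B - A) {0<..}"
proof -
  have cont: "isCont G t" if "t > 0" for t
    using G[OF that] has_vector_derivative_continuous by blast
  have fin: "(g has_integral G k - G 1) {1..k}" if "k \<ge> 1" for k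
    by (rule fundamental_theorem_of_calculus_interior)
       (use that G cont in \<open>auto intro!: continuous_at_imp_continuous_on\<close>)
  \<comment> \<open>Filling in the limit at 0 makes the fundamental theorem applicable on the closed
    interval.\<close>
  define G1 where "G1 = (\<lambda>t. if t = 0 then A else G t)"
  have "(g has_integral G1 1 - G1 0) {0..1}"
  proof (rule fundamental_theorem_of_calculus_interior)
    show "continuous_on {0..1} G1"
      unfolding continuous_on_def
    proof
      fix t :: real assume t: "t \<in> {0..1}"
      show "(G1 \<longlongrightarrow> G1 t) (at t within {0..1})"
      proof (cases "t = 0")
        case True
        have "(G1 \<longlongrightarrow> A) (at_right 0)"
          using A by (rule Lim_transform_eventually) (auto simp: eventually_at_filter G1_def)
        then show ?thesis using True by (simp add: G1_def at_within_Icc_at_right)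
      next
        case False
        then have "t > 0" using t by auto
        then have "(G \<longlongrightarrow> G t) (at t within {0..1})"
          using cont isCont_def tendsto_within_subset by blast
        moreover have "\<forall>\<^sub>F s in at t within {0..1}. G s = G1 s"
          using order_tendstoD(1)[OF tendsto_ident_at \<open>t > 0\<close>]
          by eventually_elim (simp add: G1_def)
        ultimately show ?thesis using False by (auto simp: G1_def intro: Lim_transform_eventually)
      qed
    qed
    show "(G1 has_vector_derivative g t) (at t)" if "t \<in> {0<..<1}" for t
      by (rule has_vector_derivative_transform_within_open[of G _ _ "{0<..}"]) (use G that in \<open>auto simp: G1_def\<close>)
  qed simp
  then have i1: "(g has_integral G 1 - A) {0..1}" by (simp add: G1_def)

  define f where "f = (\<lambda>k t. if t \<in> {1..real (Suc k)} then g t else 0)"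
  have f: "((f k) has_integral G (real (Suc k)) - G 1) {1..}" for k
  proof -
    have "((\<lambda>t. if t \<in> {1..real (Suc k)} then g t else 0) has_integral G (real (Suc k)) - G 1) UNIV"
      using fin[of "real (Suc k)"] by (subst has_integral_restrict_UNIV) auto
    then have "(f k has_integral G (real (Suc k)) - G 1) UNIV" by (simp add: f_def)
    moreover have "f k t = 0" if "t \<notin> {1..}" for t using that by (auto simp: f_def)
    ultimately show ?thesis by (subst has_integral_restrict_UNIV[symmetric]) (auto elim!: has_integral_eq[rotated])
  qed
  have C: "C \<ge> 0" using g[of 1] norm_ge_zero[of "g 1"]
    by (metis (no_types, opaque_lifting) exp_gt_zero order.refl order_trans zero_le_mult_iff linorder_not_less)
  have h: "(\<lambda>t::real. C * exp (- t)) integrable_on {1..}"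
    using integrable_on_mult_right[OF integrable_on_exp_minus_to_infinity[of 1 1], of C] by simp
  have le: "norm (f k t) \<le> C * exp (- t)" if "t \<in> {1..}" for k t
    using g[of t] that C by (auto simp: f_def)
  have conv: "(\<lambda>k. f k t) \<longlonglongrightarrow> g t" if "t \<in> {1..}" for t
  proof (rule tendsto_eventually)
    show "\<forall>\<^sub>F k in sequentially. f k t = g t"
      using eventually_ge_at_top[of "nat \<lceil>t\<rceil>"]
    proof eventually_elim
      case (elim k)
      then have "t \<le> real (Suc k)" by linarith
      then show ?case using that by (simp add: f_def)
    qed
  qed
  have dc: "g integrable_on {1..}" "(\<lambda>k. integral {1..} (f k)) \<longlonglongrightarrow> integral {1..} g"
    using dominated_convergence[of f "{1..}", OF _ h le conv] f has_integral_integrable by blast+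
  have "(\<lambda>k. G (real (Suc k)) - G 1) \<longlonglongrightarrow> B - G 1"
    by (intro tendsto_intros filterlim_compose[OF B] filterlim_compose[OF filterlim_real_sequentially filterlim_Suc])
  moreover have "integral {1..} (f k) = G (real (Suc k)) - G 1" for k using f by (rule integral_unique)
  ultimately have "integral {1..} g = B - G 1" using LIMSEQ_unique[OF dc(2)] by simp
  then have i2: "(g has_integral B - G 1) {1..}" using dc(1) by (simp add: has_integral_integrable_integral)
  have "(g has_integral (G 1 - A) + (B - G 1)) ({0..1} \<union> {1..})"
    by (rule has_integral_Un[OF i1 i2]) (rule negligible_subset[of "{1}"]; auto)
  moreover have "{0..1} \<union> {1..} = {0::real..}" by auto
  ultimately have "(g has_integral B - A) {0..}" by simp
  then show ?thesis
    by (subst has_integral_spike_set_eq[of _ "{0..}"]) (auto intro: negligible_subset[of "{0}"])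
qed

lemma of_rat_complex: "(of_rat q :: complex) = of_real (of_rat q)"
  by (cases q) (simp add: of_rat_rat)

section \<open>Geodesic integrals\<close>

lemma up_integral_eq:
  assumes F: "\<And>z. Im z > 0 \<Longrightarrow> (F has_field_derivative f z) (at z)" and f: "decays f"
    and A: "climit F (Fin r) A" and B: "climit F Inf B"
  shows "up_integral f r = B - A"
proof -
  define x :: real where "x = of_rat r"
  have r: "(of_rat r :: complex) = of_real x" by (simp add: x_def of_rat_complex)
  define G where "G = (\<lambda>t. F (Complex x t))"
  have z: "of_rat r + \<i> * complex_of_real t = Complex x t" for t by (simp add: r complex_eq_iff)
  obtain C where C: "\<And>z. \<bar>Re z\<bar> \<le> \<bar>x\<bar> \<Longrightarrow> Im z \<ge> 1 \<Longrightarrow> norm (f z) \<le> C * exp (- Im z)"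
    using f unfolding decays_def by blast
  have "((\<lambda>t. f (Complex x t) * \<i>) has_integral B - A) {0<..}"
  proof (rule has_integral_Ioi[of G])
    show "(G has_vector_derivative f (Complex x t) * \<i>) (at t)" if "t > 0" for t
      using field_vector_diff_chain_at[OF Complex_vector_derivative[of x t] F[of "Complex x t"]] that
      by (simp add: o_def G_def mult.commute)
    show "(G \<longlongrightarrow> B) at_top" unfolding G_def by (rule climit_Inf_D[OF B])
    have "((\<lambda>t. F (of_rat r - 1 / Complex 0 (inverse t))) \<longlongrightarrow> A) (at_right 0)"
      by (rule filterlim_compose[OF climit_Fin_D[OF A] filterlim_inverse_at_top_right])
    moreover have "\<forall>\<^sub>F t in at_right 0. F (of_rat r - 1 / Complex 0 (inverse t)) = G t"
      using eventually_at_right_less[of 0]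
    proof eventually_elim
      case (elim t)
      have "of_rat r - 1 / Complex 0 (inverse t) = Complex x t"
        using elim by (simp add: r complex_eq_iff Re_divide Im_divide power2_eq_square field_simps)
      then show ?case by (simp add: G_def)
    qed
    ultimately show "(G \<longlongrightarrow> A) (at_right 0)" by (rule Lim_transform_eventually)
    show "norm (f (Complex x t) * \<i>) \<le> C * exp (- t)" if "t \<ge> 1" for t
      using C[of "Complex x t"] that by (simp add: norm_mult)
  qed
  then show ?thesis unfolding up_integral_def z by (rule integral_unique)
qed

text \<open>1 / (1 - exp(i theta)) has constant real part 1/2 and imaginary part cot(theta / 2) / 2,
  so the semicircle becomes a vertical line in the coordinate of
  \<open>climit_Fin_D\<close>.\<close>

lemma semicircle_upper_end:
  assumes "\<rho> > 0" "0 < \<theta>" "\<theta> < pi"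
  shows "of_real \<rho> * (1 - exp (\<i> * complex_of_real \<theta>)) = 1 / Complex (1 / (2 * \<rho>)) (tan ((pi - \<theta>) / 2) / (2 * \<rho>))"
proof -
  define s k where "s = sin (\<theta> / 2)" and "k = cos (\<theta> / 2)"
  have s: "s > 0" unfolding s_def using assms by (intro sin_gt_zero) auto
  have sk: "s * s + k * k = 1" unfolding s_def k_def using sin_cos_squared_add[of "\<theta>/2"] by (simp add: power2_eq_square)
  have t: "tan ((pi - \<theta>) / 2) = k / s"
    unfolding tan_def using sin_cos_eq[of "\<theta>/2"] cos_sin_eq[of "\<theta>/2"] by (simp add: s_def k_def diff_divide_distrib)
  have st: "sin \<theta> = 2 * s * k" "cos \<theta> = 1 - 2 * s * s"
    using sin_double[of "\<theta>/2"] cos_double_sin[of "\<theta>/2"] by (simp_all add: s_def k_def power2_eq_square)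
  have w: "exp (\<i> * complex_of_real \<theta>) = Complex (1 - 2 * s * s) (2 * s * k)"
    unfolding cis_conv_exp[symmetric] by (simp add: complex_eq_iff st)
  have "of_real \<rho> * (1 - exp (\<i> * complex_of_real \<theta>)) * Complex (1 / (2 * \<rho>)) (tan ((pi - \<theta>) / 2) / (2 * \<rho>)) = of_real (s * s + k * k)"
    unfolding w t using s assms(1) by (simp add: complex_eq_iff field_simps)
  moreover have "Complex (1 / (2 * \<rho>)) (tan ((pi - \<theta>) / 2) / (2 * \<rho>)) \<noteq> 0"
    using assms(1) by (simp add: complex_eq_iff)
  ultimately show ?thesis unfolding sk by (simp add: nonzero_eq_divide_eq)
qed

lemma filterlim_tan_half:
  shows "filterlim (\<lambda>\<theta>. tan ((pi - \<theta>) / 2)) at_top (at_right 0)"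
    and "filterlim (\<lambda>\<theta>. tan (\<theta> / 2)) at_top (at_left pi)"
proof -
  have "filterlim (\<lambda>\<theta>::real. (pi - \<theta>) / 2) (at_left (pi / 2)) (at_right 0)"
    unfolding filterlim_at
    by (auto intro!: tendsto_eq_intros simp: eventually_at_filter)
  from filterlim_compose[OF filterlim_tan_at_left this]
  show "filterlim (\<lambda>\<theta>. tan ((pi - \<theta>) / 2)) at_top (at_right 0)" .
  have "filterlim (\<lambda>\<theta>::real. \<theta> / 2) (at_left (pi / 2)) (at_left pi)"
    unfolding filterlim_at
    by (auto intro!: tendsto_eq_intros simp: eventually_at_filter)
  from filterlim_compose[OF filterlim_tan_at_left this]
  show "filterlim (\<lambda>\<theta>. tan (\<theta> / 2)) at_top (at_left pi)" .
qed

lemma semi_integral_eq: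
  assumes F: "\<And>z. Im z > 0 \<Longrightarrow> (F has_field_derivative f z) (at z)"
    and A: "climit F (Fin lo) A" and B: "climit F (Fin hi) B" and "lo < hi"
  shows "semi_integral f lo hi = A - B"
proof -
  define \<rho> :: real where "\<rho> = of_rat ((hi - lo) / 2)"
  have \<rho>: "\<rho> > 0" using \<open>lo < hi\<close> by (simp add: \<rho>_def)
  \<comment> \<open>The arc starts at \<open>hi\<close> for theta = 0 and ends at \<open>lo\<close>
    for theta = pi, so the centre is expressed from either end.\<close>
  have c1: "of_rat ((lo + hi) / 2) = (of_rat hi :: complex) - of_real \<rho>"
    and c2: "of_rat ((lo + hi) / 2) = (of_rat lo :: complex) + of_real \<rho>"
    by (simp_all add: \<rho>_def flip: of_rat_complex of_rat_diff of_rat_add) (simp_all add: field_simps)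
  define w where "w = (\<lambda>\<theta>. of_rat ((lo + hi) / 2) + of_real \<rho> * exp (\<i> * complex_of_real \<theta>))"
  define w' where "w' = (\<lambda>\<theta>. \<i> * of_real \<rho> * exp (\<i> * complex_of_real \<theta>))"
  have Imw: "Im (w \<theta>) > 0" if "0 < \<theta>" "\<theta> < pi" for \<theta>
    using \<rho> sin_gt_zero[OF that] by (simp add: w_def of_rat_complex cis_conv_exp[symmetric])
  have dw: "(w has_vector_derivative w' \<theta>) (at \<theta>)" for \<theta>
    unfolding w_def w'_def
    by (rule has_vector_derivative_real_field) (auto intro!: derivative_eq_intros)
  have dF: "((\<lambda>\<theta>. F (w \<theta>)) has_vector_derivative f (w \<theta>) * w' \<theta>) (at \<theta>)" if "0 < \<theta>" "\<theta> < pi" for \<theta>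
    using field_vector_diff_chain_at[OF dw F[OF Imw[OF that]]] by (simp add: o_def mult.commute)
  have ev0: "\<forall>\<^sub>F \<theta> in at_right 0. 0 < \<theta> \<and> \<theta> < pi"
    using eventually_at_right_less[of 0] order_tendstoD(2)[OF tendsto_ident_at pi_gt_zero, of "{0<..}"]
    by eventually_elim auto
  have evpi: "\<forall>\<^sub>F \<theta> in at_left pi. 0 < \<theta> \<and> \<theta> < pi"
    using eventually_at_left_real[OF pi_gt_zero] order_tendstoD(1)[OF tendsto_ident_at pi_gt_zero, of "{..<pi}"]
    by eventually_elim auto
  have l0: "((\<lambda>\<theta>. F (w \<theta>)) \<longlongrightarrow> B) (at_right 0)"
  proof -
    have "filterlim (\<lambda>\<theta>. 1 / (2 * \<rho>) * tan ((pi - \<theta>) / 2)) at_top (at_right 0)"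
      using \<rho> by (intro filterlim_tendsto_pos_mult_at_top[OF tendsto_const] filterlim_tan_half) auto
    from filterlim_compose[OF climit_Fin_D[OF B, of "1 / (2 * \<rho>)"] this]
    have "((\<lambda>\<theta>. F (of_rat hi - 1 / Complex (1 / (2 * \<rho>)) (1 / (2 * \<rho>) * tan ((pi - \<theta>) / 2)))) \<longlongrightarrow> B) (at_right 0)" .
    moreover have "\<forall>\<^sub>F \<theta> in at_right 0.
        F (of_rat hi - 1 / Complex (1 / (2 * \<rho>)) (1 / (2 * \<rho>) * tan ((pi - \<theta>) / 2))) = F (w \<theta>)"
      using ev0
    proof eventually_elim
      case (elim \<theta>)
      have "w \<theta> = of_rat hi - of_real \<rho> * (1 - exp (\<i> * complex_of_real \<theta>))"
        unfolding w_def c1 by (simp add: right_diff_distrib)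
      also have "of_real \<rho> * (1 - exp (\<i> * complex_of_real \<theta>))
          = 1 / Complex (1 / (2 * \<rho>)) (1 / (2 * \<rho>) * tan ((pi - \<theta>) / 2))"
        using semicircle_upper_end[OF \<rho>, of \<theta>] elim by simp
      finally show ?case by simp
    qed
    ultimately show ?thesis by (rule Lim_transform_eventually)
  qed
  have lpi: "((\<lambda>\<theta>. F (w \<theta>)) \<longlongrightarrow> A) (at_left pi)"
  proof -
    have "filterlim (\<lambda>\<theta>. 1 / (2 * \<rho>) * tan (\<theta> / 2)) at_top (at_left pi)"
      using \<rho> by (intro filterlim_tendsto_pos_mult_at_top[OF tendsto_const] filterlim_tan_half) auto
    from filterlim_compose[OF climit_Fin_D[OF A, of "- 1 / (2 * \<rho>)"] this]
    have "((\<lambda>\<theta>. F (of_rat lo - 1 / Complex (- 1 / (2 * \<rho>)) (1 / (2 * \<rho>) * tan (\<theta> / 2)))) \<longlongrightarrow> A) (at_left pi)" .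
    moreover have "\<forall>\<^sub>F \<theta> in at_left pi.
        F (of_rat lo - 1 / Complex (- 1 / (2 * \<rho>)) (1 / (2 * \<rho>) * tan (\<theta> / 2))) = F (w \<theta>)"
      using evpi
    proof eventually_elim
      case (elim \<theta>)
      \<comment> \<open>the reflection \<open>z \<mapsto> - cnj z\<close> exchanges the two ends of the semicircle\<close>
      have "exp (\<i> * complex_of_real (pi - \<theta>)) = - cnj (exp (\<i> * complex_of_real \<theta>))"
        unfolding cis_conv_exp[symmetric] by (simp add: complex_eq_iff)
      then have "of_real \<rho> * (1 + cnj (exp (\<i> * complex_of_real \<theta>)))
          = 1 / Complex (1 / (2 * \<rho>)) (tan (\<theta> / 2) / (2 * \<rho>))"
        using semicircle_upper_end[OF \<rho>, of "pi - \<theta>"] elim by simp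
      from arg_cong[OF this, of cnj]
      have "of_real \<rho> * (1 + exp (\<i> * complex_of_real \<theta>))
          = 1 / Complex (1 / (2 * \<rho>)) (- (tan (\<theta> / 2) / (2 * \<rho>)))"
        by (simp add: complex_cnj)
      also have "Complex (1 / (2 * \<rho>)) (- (tan (\<theta> / 2) / (2 * \<rho>))) = - Complex (- 1 / (2 * \<rho>)) (1 / (2 * \<rho>) * tan (\<theta> / 2))"
        by (simp add: complex_eq_iff)
      finally have "of_real \<rho> + of_real \<rho> * exp (\<i> * complex_of_real \<theta>) = - 1 / Complex (- 1 / (2 * \<rho>)) (1 / (2 * \<rho>) * tan (\<theta> / 2))"
        by (simp add: algebra_simps)
      then have "w \<theta> = of_rat lo - 1 / Complex (- 1 / (2 * \<rho>)) (1 / (2 * \<rho>) * tan (\<theta> / 2))"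
        unfolding w_def c2 by (simp add: add.assoc)
      then show ?case by simp
    qed
    ultimately show ?thesis by (rule Lim_transform_eventually)
  qed
  define G where "G = (\<lambda>\<theta>. if \<theta> = 0 then B else if \<theta> = pi then A else F (w \<theta>))"
  have "((\<lambda>\<theta>. f (w \<theta>) * w' \<theta>) has_integral G pi - G 0) {0..pi}"
  proof (rule fundamental_theorem_of_calculus_interior)
    show "continuous_on {0..pi} G"
    proof (rule continuous_on_IccI)
      show "(G \<longlongrightarrow> G 0) (at_right 0)"
        using l0 ev0 by (auto simp: G_def elim!: Lim_transform_eventually eventually_mono)
      show "(G \<longlongrightarrow> G pi) (at_left pi)"
        using lpi evpi by (auto simp: G_def elim!: Lim_transform_eventually eventually_mono)
      fix \<theta> :: real assume t: "0 < \<theta>" "\<theta> < pi"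
      have "((\<lambda>\<theta>. F (w \<theta>)) \<longlongrightarrow> F (w \<theta>)) (at \<theta>)"
        using has_vector_derivative_continuous[OF dF[OF t]] by (simp add: isCont_def)
      moreover have "\<forall>\<^sub>F s in at \<theta>. F (w s) = G s"
        using order_tendstoD(1)[OF tendsto_ident_at t(1)] order_tendstoD(2)[OF tendsto_ident_at t(2)]
        by eventually_elim (simp add: G_def)
      ultimately show "(G \<longlongrightarrow> G \<theta>) (at \<theta>)"
        using t by (simp add: G_def[abs_def] Lim_transform_eventually)
    qed simp
    show "(G has_vector_derivative f (w \<theta>) * w' \<theta>) (at \<theta>)" if "\<theta> \<in> {0<..<pi}" for \<theta>
      by (rule has_vector_derivative_transform_within_open[of "\<lambda>\<theta>. F (w \<theta>)" _ _ "{0<..<pi}"])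
         (use dF that in \<open>auto simp: G_def\<close>)
  qed simp
  then have "((\<lambda>\<theta>. f (w \<theta>) * w' \<theta>) has_integral A - B) {0<..<pi}"
    by (simp add: G_def has_integral_Icc_iff_Ioo)
  then show ?thesis
    unfolding semi_integral_def Let_def w_def w'_def \<rho>_def of_rat_complex[symmetric]
    by (rule integral_unique)
qed

lemma geodesic_integral_eq:
  assumes F: "\<And>z. Im z > 0 \<Longrightarrow> (F has_field_derivative f z) (at z)" and f: "decays f"
    and L: "\<And>r. climit F r (L r)"
  shows "geodesic_integral f s r = L r - L s"
  using semi_integral_eq[OF F L L] up_integral_eq[OF F f L L]
  by (cases s; cases r) auto

text \<open>Fixes primitives and their boundary values once and for all. Additivity is then
  telescoping, and the group and Hecke actions become statements about primitives rather than
  integrals.\<close>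

lemma modular_symbol_data:
  obtains F L where "\<And>j z. Im z > 0 \<Longrightarrow> (F j has_field_derivative Delta z * z ^ j) (at z)"
    and "\<And>j r. j \<le> 10 \<Longrightarrow> climit (F j) r (L j r)"
    and "\<And>j r s. j \<le> 10 \<Longrightarrow> msym j r s = 2 * complex_of_real pi * \<i> * of_nat (10 choose j) * (L j r - L j s)"
proof -
  have "\<exists>F. \<forall>z. Im z > 0 \<longrightarrow> (F has_field_derivative Delta z * z ^ j) (at z)" for j
  proof -
    have "(\<lambda>z. Delta z * z ^ j) holomorphic_on {z. Im z > 0}"
      by (intro holomorphic_intros holomorphic_on_Delta)
    then obtain F where "\<And>z. z \<in> {z. Im z > 0} \<Longrightarrow> (F has_field_derivative Delta z * z ^ j) (at z within {z. Im z > 0})"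
      using holomorphic_convex_primitive'[OF convex_halfspace_Im_gt open_halfspace_Im_gt] by blast
    then show ?thesis using at_within_open[OF _ open_halfspace_Im_gt] by (metis mem_Collect_eq)
  qed
  then obtain F where F: "\<And>j z. Im z > 0 \<Longrightarrow> (F j has_field_derivative Delta z * z ^ j) (at z)"
    by metis
  have "\<forall>j r. \<exists>L. j \<le> 10 \<longrightarrow> climit (F j) r L" using primitive_climit_exists[OF F] by blast
  then obtain L where L: "\<And>j r. j \<le> 10 \<Longrightarrow> climit (F j) r (L j r)" by metis
  have "decays (\<lambda>z. Delta z * z ^ j)" for j
    using decays_Delta_poly[of "monom 1 j"] by (simp add: poly_monom)
  then have "msym j r s = 2 * complex_of_real pi * \<i> * of_nat (10 choose j) * (L j r - L j s)" if "j \<le> 10" for j r s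
    unfolding msym_def using geodesic_integral_eq[OF F _ L[OF that]] by simp
  then show ?thesis using that F L by blast
qed

section \<open>The period polynomial\<close>

definition msymP :: "complex \<Rightarrow> complex \<Rightarrow> cusp \<Rightarrow> cusp \<Rightarrow> complex" where
  "msymP X Y r s = (\<Sum>j\<le>10. msym j r s * X ^ j * Y ^ (10 - j))"

lemma msym_add:
  assumes "j \<le> 10" shows "msym j r s + msym j s t = msym j r t"
proof -
  obtain F L where "\<And>j r s. j \<le> 10 \<Longrightarrow> msym j r s = 2 * complex_of_real pi * \<i> * of_nat (10 choose j) * (L j r - L j s)"
    by (rule modular_symbol_data) blast
  note m = this[OF assms]
  show ?thesis unfolding m by (simp add: algebra_simps)
qed

text \<open>A primitive composed with the matrix is a primitive of the form in the transformed
  variables. The two primitives differ by a constant, which cancels between the endpoints.\<close>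

lemma msymP_moebius:
  assumes g: "a * d - b * c = 1"
  shows "msymP X Y (moebius a b c d r) (moebius a b c d s)
    = msymP (of_int a * X + of_int c * Y) (of_int b * X + of_int d * Y) r s"
proof -
  obtain F L where F: "\<And>j z. Im z > 0 \<Longrightarrow> (F j has_field_derivative Delta z * z ^ j) (at z)"
    and L: "\<And>j r. j \<le> 10 \<Longrightarrow> climit (F j) r (L j r)"
    and m: "\<And>j r s. j \<le> 10 \<Longrightarrow> msym j r s = 2 * complex_of_real pi * \<i> * of_nat (10 choose j) * (L j r - L j s)"
    by (rule modular_symbol_data) blast
  define FF where "FF = (\<lambda>X Y z. \<Sum>j\<le>10. of_nat (10 choose j) * X ^ j * Y ^ (10 - j) * F j z)"
  define LL where "LL = (\<lambda>X Y r. \<Sum>j\<le>10. of_nat (10 choose j) * X ^ j * Y ^ (10 - j) * L j r)"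
  have FF: "(FF X Y has_field_derivative Delta z * (z * X + Y) ^ 10) (at z)" if "Im z > 0" for X Y z
  proof -
    have "(FF X Y has_field_derivative (\<Sum>j\<le>10. of_nat (10 choose j) * X ^ j * Y ^ (10 - j) * (Delta z * z ^ j))) (at z)"
      unfolding FF_def by (intro DERIV_sum DERIV_cmult F that)
    also have "(\<Sum>j\<le>10. of_nat (10 choose j) * X ^ j * Y ^ (10 - j) * (Delta z * z ^ j)) = Delta z * (z * X + Y) ^ 10"
      unfolding binomial_ring sum_distrib_left
      by (intro sum.cong refl) (simp add: power_mult_distrib mult_ac)
    finally show ?thesis .
  qed
  have LL: "climit (FF X Y) r (LL X Y r)" for X Y r
    unfolding FF_def LL_def by (intro climit_sum climit_mult_left L) auto
  have mP: "msymP X Y r s = 2 * complex_of_real pi * \<i> * (LL X Y r - LL X Y s)" for X Y r s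
    unfolding msymP_def LL_def sum_subtractf[symmetric] sum_distrib_left
    by (intro sum.cong refl) (simp add: m algebra_simps)
  \<comment> \<open>The transposed matrix acts on (X, Y), because (c z + d) (g z X + Y) = z X' +
    Y'.\<close>
  define X' Y' where "X' = of_int a * X + of_int c * Y" and "Y' = of_int b * X + of_int d * Y"
  have "((\<lambda>z. FF X Y (mob a b c d z) - FF X' Y' z) has_field_derivative 0) (at z)" if z: "Im z > 0" for z
  proof -
    have nz: "of_int c * z + of_int d \<noteq> 0" by (rule mob_denom_nonzero[OF g z])
    have "(of_int c * z + of_int d) * (mob a b c d z * X + Y) = z * X' + Y'"
      using nz by (simp add: mob_def X'_def Y'_def field_simps)
    then have "(of_int c * z + of_int d) ^ 10 * (mob a b c d z * X + Y) ^ 10 = (z * X' + Y') ^ 10"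
      by (metis power_mult_distrib)
    then have "((\<lambda>z. FF X Y (mob a b c d z)) has_field_derivative Delta z * (z * X' + Y') ^ 10) (at z)"
      using primitive_mob[OF FF g z, of X Y] by simp
    from DERIV_diff[OF this FF[OF z, of X' Y']] show ?thesis by simp
  qed
  then obtain k where "\<And>z. z \<in> {z. Im z > 0} \<Longrightarrow> FF X Y (mob a b c d z) - FF X' Y' z = k"
    using has_field_derivative_zero_constant[OF convex_halfspace_Im_gt[of 0], of "\<lambda>z. FF X Y (mob a b c d z) - FF X' Y' z"]
    by (metis has_field_derivative_at_within mem_Collect_eq)
  then have k: "FF X Y (mob a b c d z) = FF X' Y' z + k" if "Im z > 0" for z
    using that by (metis add.commute diff_add_cancel mem_Collect_eq)
  have "LL X Y (moebius a b c d r) = LL X' Y' r + k" for r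
  proof (rule climit_unique[OF LL climit_moebius[OF g]])
    show "climit (\<lambda>z. FF X Y (mob a b c d z)) r (LL X' Y' r + k)"
    proof (rule climit_cong[THEN iffD2])
      show "climit (\<lambda>z. FF X' Y' z + k) r (LL X' Y' r + k)" by (intro climit_add LL climit_const)
    qed (rule k)
  qed
  then show ?thesis unfolding mP X'_def[symmetric] Y'_def[symmetric] by simp
qed

text \<open>A constant combination of primitives is compared at two cusps: at Inf every argument
  tends to Inf, while at 0 the branch (z + 1) / 2 tends to 1/2. The constant is 1049 = 2^10 + 1 +
  24.\<close>

lemma msym_Hecke_2: "msym 0 Inf (Fin (1 / 2)) = - 1049 * msym 0 Inf (Fin 0)"
proof -
  obtain F L where F: "\<And>j z. Im z > 0 \<Longrightarrow> (F j has_field_derivative Delta z * z ^ j) (at z)"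
    and L: "\<And>j r. j \<le> 10 \<Longrightarrow> climit (F j) r (L j r)"
    and m: "\<And>j r s. j \<le> 10 \<Longrightarrow> msym j r s = 2 * complex_of_real pi * \<i> * of_nat (10 choose j) * (L j r - L j s)"
    by (rule modular_symbol_data) blast
  define f where "f = F 0"
  define l where "l = L 0"
  have f: "(f has_field_derivative Delta z) (at z)" if "Im z > 0" for z
    using F[OF that, of 0] by (simp add: f_def)
  have l: "climit f r (l r)" for r using L[of 0 r] by (simp add: f_def l_def)
  \<comment> \<open>A primitive of the Hecke relation: integrating \<open>Delta (2 * z)\<close>
    halves 2^11, and the half arguments bring a factor 2 that cancels the 1/2.\<close>
  define T where "T = (\<lambda>z. 2 ^ 10 * f (2 * z) + f (z / 2) + f ((z + 1) / 2) + 24 * f z)"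
  have "(T has_field_derivative 0) (at z)" if z: "Im z > 0" for z
  proof -
    have 1: "((\<lambda>z. f (2 * z)) has_field_derivative Delta (2 * z) * 2) (at z)"
      by (rule DERIV_chain2[OF f]) (use z in \<open>auto intro!: derivative_eq_intros\<close>)
    have 2: "((\<lambda>z. f (z / 2)) has_field_derivative Delta (z / 2) * (1 / 2)) (at z)"
      by (rule DERIV_chain2[OF f]) (use z in \<open>auto intro!: derivative_eq_intros\<close>)
    have 3: "((\<lambda>z. f ((z + 1) / 2)) has_field_derivative Delta ((z + 1) / 2) * (1 / 2)) (at z)"
      by (rule DERIV_chain2[OF f]) (use z in \<open>auto intro!: derivative_eq_intros\<close>)
    have "(T has_field_derivative 2 ^ 10 * (Delta (2 * z) * 2) + Delta (z / 2) * (1 / 2)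
        + Delta ((z + 1) / 2) * (1 / 2) + 24 * Delta z) (at z)"
      unfolding T_def by (intro DERIV_add DERIV_cmult 1 2 3 f z)
    also have "2 ^ 10 * (Delta (2 * z) * 2) + Delta (z / 2) * (1 / 2) + Delta ((z + 1) / 2) * (1 / 2) + 24 * Delta z = 0"
      using Delta_Hecke_2[OF z] by (simp add: field_simps)
    finally show ?thesis .
  qed
  then obtain k where k: "\<And>z. Im z > 0 \<Longrightarrow> T z = k"
    using has_field_derivative_zero_constant[OF convex_halfspace_Im_gt[of 0], of T]
    by (metis has_field_derivative_at_within mem_Collect_eq)
  have scale: "filterlim (\<lambda>y::real. y * e) at_top at_top" if "e > 0" for e
    using filterlim_tendsto_pos_mult_at_top[OF tendsto_const that filterlim_ident] by (simp add: mult.commute)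
  have lim: "2 ^ 10 * A + B + C + 24 * D = k"
    if z: "\<And>y. y > 0 \<Longrightarrow> Im (z y) > 0"
      and "((\<lambda>y. f (2 * z y)) \<longlongrightarrow> A) at_top" "((\<lambda>y. f (z y / 2)) \<longlongrightarrow> B) at_top"
      "((\<lambda>y. f ((z y + 1) / 2)) \<longlongrightarrow> C) at_top" "((\<lambda>y. f (z y)) \<longlongrightarrow> D) at_top"
    for z :: "real \<Rightarrow> complex" and A B C D
  proof (rule tendsto_unique)
    show "((\<lambda>y. T (z y)) \<longlongrightarrow> 2 ^ 10 * A + B + C + 24 * D) at_top"
      unfolding T_def using that by (intro tendsto_intros)
    have "\<forall>\<^sub>F y in at_top. k = T (z y)"
      using eventually_gt_at_top[of 0] by eventually_elim (simp add: k z)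
    then show "((\<lambda>y. T (z y)) \<longlongrightarrow> k) at_top" by (rule Lim_transform_eventually[OF tendsto_const])
  qed simp
  have "2 ^ 10 * l Inf + l Inf + l Inf + 24 * l Inf = k"
  proof (rule lim[of "\<lambda>y. Complex 0 y"])
    have "2 * Complex 0 y = Complex 0 (y * 2)" "Complex 0 y / 2 = Complex 0 (y * (1 / 2))"
      "(Complex 0 y + 1) / 2 = Complex (1 / 2) (y * (1 / 2))" for y
      by (simp_all add: complex_eq_iff)
    note e = this
    show "((\<lambda>y. f (2 * Complex 0 y)) \<longlongrightarrow> l Inf) at_top" "((\<lambda>y. f (Complex 0 y / 2)) \<longlongrightarrow> l Inf) at_top"
      "((\<lambda>y. f ((Complex 0 y + 1) / 2)) \<longlongrightarrow> l Inf) at_top"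
      unfolding e by (rule filterlim_compose[OF climit_Inf_D[OF l] scale], simp)+
    show "((\<lambda>y. f (Complex 0 y)) \<longlongrightarrow> l Inf) at_top" by (rule climit_Inf_D[OF l])
  qed simp
  moreover have "2 ^ 10 * l (Fin 0) + l (Fin 0) + l (Fin (1 / 2)) + 24 * l (Fin 0) = k"
  proof (rule lim[of "\<lambda>y. - 1 / Complex 0 y"])
    have "2 * (- 1 / Complex 0 y) = of_rat 0 - 1 / Complex 0 (y * (1 / 2))"
      "- 1 / Complex 0 y / 2 = of_rat 0 - 1 / Complex 0 (y * 2)"
      "(- 1 / Complex 0 y + 1) / 2 = of_rat (1 / 2) - 1 / Complex 0 (y * 2)"
      "- 1 / Complex 0 y = of_rat 0 - 1 / Complex 0 (y * 1)" for y
      by (simp_all add: complex_eq_iff Re_divide Im_divide power2_eq_square of_rat_divide)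
    note e = this
    show "((\<lambda>y. f (2 * (- 1 / Complex 0 y))) \<longlongrightarrow> l (Fin 0)) at_top"
      "((\<lambda>y. f (- 1 / Complex 0 y / 2)) \<longlongrightarrow> l (Fin 0)) at_top"
      "((\<lambda>y. f ((- 1 / Complex 0 y + 1) / 2)) \<longlongrightarrow> l (Fin (1 / 2))) at_top"
      unfolding e(1-3) by (rule filterlim_compose[OF climit_Fin_D[OF l] scale], simp)+
    show "((\<lambda>y. f (- 1 / Complex 0 y)) \<longlongrightarrow> l (Fin 0)) at_top"
      unfolding e(4) by (rule filterlim_compose[OF climit_Fin_D[OF l] scale], simp)
    show "Im (- 1 / Complex 0 y) > 0" if "y > 0" for y
      using that by (simp add: Im_divide power2_eq_square)
  qed
  ultimately have h: "l Inf - l (Fin (1 / 2)) = - 1049 * (l Inf - l (Fin 0))" by (simp add: algebra_simps)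
  show ?thesis unfolding m[of 0, OF le0] l_def[symmetric] h by (simp only: mult_ac)
qed

section \<open>The plus part of the symbol\<close>

lemma cusp_neg_cusp_of: "cusp_neg (cusp_of x y) = cusp_of (- x) y"
  by (simp add: cusp_of_def)

lemma cusp_neg_moebius:
  assumes "a * d - b * c = 1"
  shows "cusp_neg (moebius a b c d r) = moebius a (- b) (- c) d (cusp_neg r)"
proof -
  obtain x y where r: "coprime x y" "r = cusp_of x y" by (rule cusp_cases)
  have xy: "x \<noteq> 0 \<or> y \<noteq> 0" using r(1) by auto
  then have xy': "- x \<noteq> 0 \<or> y \<noteq> 0" by simp
  have det': "a * d - (- b) * (- c) = 1" using assms by simp
  show ?thesis
    unfolding r(2) moebius_cusp_of[OF assms xy] cusp_neg_cusp_of moebius_cusp_of[OF det' xy']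
    by simp
qed

definition plusP :: "complex \<Rightarrow> complex \<Rightarrow> cusp \<Rightarrow> cusp \<Rightarrow> complex" where
  "plusP X Y r s = (\<Sum>j\<le>10. msym_plus j r s * X ^ j * Y ^ (10 - j))"

lemma plusP_eq: "plusP X Y r s = (msymP X Y r s + msymP X (- Y) (cusp_neg r) (cusp_neg s)) / 2"
proof -
  have "(- Y) ^ n = (- 1) ^ n * Y ^ n" for n by (rule power_minus)
  then show ?thesis
    unfolding plusP_def msymP_def msym_plus_def sum.distrib[symmetric] sum_divide_distrib
    by (intro sum.cong refl) (simp add: field_simps)
qed

text \<open>Conjugation by diag(-1, 1) negates the off-diagonal entries and stays in SL_2(Z), so
  averaging preserves equivariance.\<close>

lemma plusP_moebius:
  assumes g: "a * d - b * c = 1"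
  shows "plusP X Y (moebius a b c d r) (moebius a b c d s)
    = plusP (of_int a * X + of_int c * Y) (of_int b * X + of_int d * Y) r s"
proof -
  have det': "a * d - (- b) * (- c) = 1" using g by simp
  have "of_int (- b) * X + of_int d * (- Y) = - (of_int b * X + of_int d * Y)"
    "of_int a * X + of_int (- c) * (- Y) = of_int a * X + of_int c * Y" by simp_all
  then show ?thesis
    unfolding plusP_eq cusp_neg_moebius[OF g] msymP_moebius[OF g] msymP_moebius[OF det'] by simp
qed

lemma msym_plus_add:
  assumes "j \<le> 10" shows "msym_plus j r s + msym_plus j s t = msym_plus j r t"
  unfolding msym_plus_def msym_add[OF assms, of r s t, symmetric]
    msym_add[OF assms, of "cusp_neg r" "cusp_neg s" "cusp_neg t", symmetric]
  by (simp add: field_simps)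

lemma plusP_add: "plusP X Y r s + plusP X Y s t = plusP X Y r t"
  unfolding plusP_def sum.distrib[symmetric]
  by (intro sum.cong refl) (simp add: msym_plus_add[symmetric, of _ r t s] algebra_simps)

lemma plusP_refl: "plusP X Y r r = 0"
  using plusP_add[of X Y r r r] by simp

lemma plusP_swap: "plusP X Y s r = - plusP X Y r s"
  using plusP_add[of X Y r s r] by (simp add: plusP_refl add_eq_0_iff)

lemma plusP_0_1: "plusP 0 1 r s = msym_plus 0 r s"
  unfolding plusP_def by (subst sum.remove[of _ 0]) (auto intro!: sum.neutral)

lemma plusP_cusp_of:
  assumes "a * d - b * c = 1"
  shows "plusP X Y (cusp_of a c) (cusp_of b d)
    = plusP (of_int a * X + of_int c * Y) (of_int b * X + of_int d * Y) Inf (Fin 0)"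
proof -
  have "moebius a b c d Inf = cusp_of a c" "moebius a b c d (Fin 0) = cusp_of b d"
    by (auto simp: cusp_of_def)
  then show ?thesis using plusP_moebius[OF assms, of X Y Inf "Fin 0"] by simp
qed

text \<open>Polymorphic because it is evaluated at complex numbers, at linear polynomials to show
  integrality of coefficients, and at integers for the congruences.\<close>

definition period_poly :: "'a::comm_ring_1 \<Rightarrow> 'a \<Rightarrow> 'a" where
  "period_poly X Y = 36 * (X ^ 10 - Y ^ 10)
     - 691 * (X ^ 8 * Y ^ 2 - 3 * (X ^ 6 * Y ^ 4) + 3 * (X ^ 4 * Y ^ 6) - X ^ 2 * Y ^ 8)"

text \<open>The relations of order 2 and 3 in \<open>SL\<^sub>2(\<int>)\<close> leave two unknown coefficients;
  the Hecke eigenvalue \<open>-24\<close> determines their ratio.\<close>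
theorem plusP_period_poly:
  "plusP X Y Inf (Fin 0) = msym_plus 10 Inf (Fin 0) / 36 * period_poly X Y"
proof -
  define m where "m = (\<lambda>j. msym_plus j Inf (Fin 0))"
  \<comment> \<open>\<open>cusp_neg\<close> fixes both endpoints, so the sign (-1)^(10 - j) makes
    the odd terms cancel.\<close>
  have odd: "m j = 0" if "odd (10 - j)" for j using that by (simp add: m_def msym_plus_def)
  have "odd (10 - 1 :: nat)" "odd (10 - 3 :: nat)" "odd (10 - 5 :: nat)" "odd (10 - 7 :: nat)" "odd (10 - 9 :: nat)"
    by simp_all
  note odd = this[THEN odd]
  have P: "plusP X Y Inf (Fin 0) = m 0 * Y ^ 10 + m 2 * X ^ 2 * Y ^ 8 + m 4 * X ^ 4 * Y ^ 6
      + m 6 * X ^ 6 * Y ^ 4 + m 8 * X ^ 8 * Y ^ 2 + m 10 * X ^ 10" for X Y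
  proof -
    have "plusP X Y Inf (Fin 0) = (\<Sum>j\<le>10. m j * X ^ j * Y ^ (10 - j))"
      unfolding plusP_def m_def ..
    also have "{..10::nat} = {0, 1, 2, 3, 4, 5, 6, 7, 8, 9, 10}"
      unfolding set_eq_iff by (simp only: atMost_iff insert_iff empty_iff) presburger
    finally show ?thesis using odd by simp
  qed
  have "cusp_of 1 0 = Inf" "cusp_of 0 1 = Fin 0" by (simp_all add: cusp_of_def)
  note c = this
  have S: "plusP Y (- X) Inf (Fin 0) = - plusP X Y Inf (Fin 0)" for X Y
    using plusP_cusp_of[of 0 0 "-1" 1 X Y] plusP_swap[of X Y Inf "Fin 0"]
      cusp_of_eq_iff[of "-1" 0 1 0] by (simp add: c)
  \<comment> \<open>The ideal triangle with vertices Inf, 0 and 1: each side is a translate of the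
    side joining Inf and 0.\<close>
  have U: "plusP X Y Inf (Fin 0) + plusP (- Y) (X + Y) Inf (Fin 0) + plusP (- X - Y) X Inf (Fin 0) = 0" for X Y
  proof -
    have "plusP X Y (Fin 0) (cusp_of 1 1) = plusP (- Y) (X + Y) Inf (Fin 0)"
      using plusP_cusp_of[of 0 1 1 "-1" X Y] cusp_of_eq_iff[of 0 "-1" 0 1] by (simp add: c)
    moreover have "plusP X Y (cusp_of 1 1) Inf = plusP (- X - Y) X Inf (Fin 0)"
      using plusP_cusp_of[of "-1" 0 1 "-1" X Y] cusp_of_eq_iff[of "-1" "-1" 1 1] by (simp add: c)
    ultimately show ?thesis
      using plusP_add[of X Y Inf "Fin 0" "cusp_of 1 1"] plusP_add[of X Y Inf "cusp_of 1 1" Inf]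
      by (simp add: plusP_refl)
  qed
  have half: "plusP 0 1 Inf (Fin (1 / 2)) = - 1049 * plusP 0 1 Inf (Fin 0)"
  proof -
    have "msymP 0 1 r s = msym 0 r s" for r s
      unfolding msymP_def by (subst sum.remove[of _ 0]) (auto intro!: sum.neutral)
    \<comment> \<open>Translation by 1 carries -1/2 to 1/2, fixes Inf and respects evaluation at (0,
      1), so the Hecke relation passes to the plus part.\<close>
    then have "msym 0 Inf (Fin (1 / 2)) = msym 0 Inf (Fin (- (1 / 2)))"
      using msymP_moebius[of 1 1 1 0 0 1 Inf "Fin (- (1 / 2))"] by simp
    then show ?thesis using msym_Hecke_2 unfolding plusP_0_1 by (simp add: msym_plus_def)
  qed
  have H: "plusP 0 1 Inf (Fin 0) + plusP (- 1) 2 Inf (Fin 0) = - 1049 * plusP 0 1 Inf (Fin 0)"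
  proof -
    have "plusP 0 1 (Fin 0) (Fin (1 / 2)) = plusP (- 1) 2 Inf (Fin 0)"
      using plusP_cusp_of[of 0 2 1 "-1" 0 1] cusp_of_eq_iff[of 0 "-1" 0 1] by (simp add: c) (simp add: cusp_of_def)
    then show ?thesis using plusP_add[of 0 1 Inf "Fin 0" "Fin (1 / 2)"] half by simp
  qed
  have 0: "m 0 = - m 10" using S[of 0 1] unfolding P by simp
  have s1: "m 2 + m 8 = - (m 4 + m 6)"
  proof -
    have "2 * (m 2 + m 8 + (m 4 + m 6)) = 0" using S[of 1 1] unfolding P 0 by (simp add: algebra_simps add_eq_0_iff)
    then have "m 2 + m 8 + (m 4 + m 6) = 0" unfolding mult_eq_0_iff by simp
    then show ?thesis by (simp add: add_eq_0_iff2)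
  qed
  \<comment> \<open>Here 260 = 2^8 + 2^2 and 80 = 2^6 + 2^4; the outer terms cancel because m 0 = -
    m 10.\<close>
  have "260 * (m 2 + m 8) + 80 * (m 4 + m 6) = 0"
    using S[of 1 2] unfolding P 0 by (simp add: algebra_simps add_eq_0_iff)
  then have "260 * (- (m 4 + m 6)) + 80 * (m 4 + m 6) = 0" unfolding s1 .
  moreover have "x = 0" if "260 * (- x) + 80 * x = 0" for x :: complex using that by simp
  ultimately have "m 4 + m 6 = 0" by blast
  then have 46: "m 4 = - m 6" and 28: "m 2 = - m 8" using s1 by (simp_all add: add_eq_0_iff2)
  have 6: "m 6 = - 3 * m 8"
  proof -
    have "- m 6 = 3 * m 8" using U[of 1 2] unfolding P 0 28 46 by (simp add: algebra_simps)
    then show ?thesis by (metis minus_minus mult_minus_left)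
  qed
  have 8: "m 8 = - 691 * (m 10 / 36)"
  proof -
    \<comment> \<open>Substitution gives -108 m 8 = (1024 + 1049) m 10. Division by 3 produces the
      constants 36 and 691.\<close>
    have "- (36 * m 8) = 691 * m 10" using H unfolding P 0 28 46 6 by (simp add: algebra_simps)
    then have "36 * m 8 = - (691 * m 10)" by (metis minus_minus)
    then show ?thesis by (simp add: field_simps)
  qed
  have "msym_plus 10 Inf (Fin 0) = m 10" by (simp add: m_def)
  then show ?thesis unfolding P 0 28 46 6 8 period_poly_def by (simp add: field_simps)
qed

section \<open>Cusps and residues modulo 5 and 7\<close>

text \<open>Manin's trick: the Euclidean algorithm joins any two cusps by a chain of
  \<open>SL\<^sub>2(\<int>)\<close>-translates of the path from \<open>0\<close> to \<open>\<infinity>\<close>.\<close>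
lemma cusp_induct:
  assumes refl: "\<And>r. R r r" and sym: "\<And>r s. R r s \<Longrightarrow> R s r"
    and trans: "\<And>r s t. R r s \<Longrightarrow> R s t \<Longrightarrow> R r t"
    and base: "\<And>a b c d. a * d - b * c = 1 \<Longrightarrow> R (cusp_of a c) (cusp_of b d)"
  shows "R r s"
proof -
  have inf: "R (cusp_of x y) Inf" if "coprime x y" for x y
    using that
  proof (induction "nat \<bar>y\<bar>" arbitrary: x y rule: less_induct)
    case less
    show ?case
    proof (cases "y = 0")
      case True then show ?thesis by (simp add: cusp_of_def refl)
    next
      case False
      obtain u v where uv: "u * x + v * y = 1" using bezout_int[of x y] less.prems by auto
      \<comment> \<open>A Bezout coefficient is free modulo y. Reducing it gives a cusp one edge
        away with a smaller denominator.\<close>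
      define k where "k = u div y"
      have "x * (u mod y) - (- v - x * k) * y = x * (u mod y + y * k) + v * y" by (simp add: algebra_simps)
      also have "u mod y + y * k = u" by (simp add: k_def)
      finally have det: "x * (u mod y) - (- v - x * k) * y = 1" using uv by (simp add: mult.commute)
      then have "coprime (- v - x * k) (u mod y)"
        by (intro coprimeI) (metis dvd_diff dvd_mult dvd_mult2)
      moreover have "nat \<bar>u mod y\<bar> < nat \<bar>y\<bar>" using False abs_mod_less[of y u] by simp
      ultimately have "R (cusp_of (- v - x * k) (u mod y)) Inf" using less.hyps by blast
      then show ?thesis using base[OF det] trans by blast
    qed
  qed
  have "R r Inf" for r by (rule cusp_cases[of r]) (use inf in auto)
  then show ?thesis using sym trans by blast
qed

section \<open>Orbits of cusps under Gamma_1(N)\<close>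

lemma coprime_int_proportional:
  fixes a c a' c' :: int
  assumes "coprime a c" "coprime a' c'" "a * c' = a' * c"
  shows "\<bar>a\<bar> = \<bar>a'\<bar>" "\<bar>c\<bar> = \<bar>c'\<bar>"
proof -
  have "a dvd a'" using assms by (metis coprime_dvd_mult_left_iff dvd_triv_left)
  moreover have "a' dvd a" using assms by (metis coprime_dvd_mult_left_iff dvd_triv_left)
  ultimately show "\<bar>a\<bar> = \<bar>a'\<bar>" by (rule zdvd_antisym_abs)
  have "c dvd c'" using assms by (metis coprime_commute coprime_dvd_mult_right_iff dvd_triv_right)
  moreover have "c' dvd c" using assms by (metis coprime_commute coprime_dvd_mult_right_iff dvd_triv_right)
  ultimately show "\<bar>c\<bar> = \<bar>c'\<bar>" by (rule zdvd_antisym_abs)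
qed

lemma cusp_of_uminus: "cusp_of (- x) (- y) = cusp_of x y"
  by (simp add: cusp_of_def)

text \<open>The primitive vector of a cusp is unique up to a common sign. If N divides its second
  entry, a matrix in Gamma_1(N) changes the first entry only by multiples of N, so its residue up to
  sign classifies the orbit.\<close>

lemma Gamma1_orbit_iff:
  assumes xy: "coprime x y" "int N dvd y" and ac: "coprime a c"
  shows "cusp_of a c \<in> Gamma1_orbit N (cusp_of x y) \<longleftrightarrow>
    int N dvd c \<and> ([a = x] (mod int N) \<or> [a = - x] (mod int N))"
proof
  assume "cusp_of a c \<in> Gamma1_orbit N (cusp_of x y)"
  then obtain \<alpha> \<beta> \<gamma> \<delta> where G: "Gamma1 N \<alpha> \<beta> \<gamma> \<delta>" and eq: "cusp_of a c = moebius \<alpha> \<beta> \<gamma> \<delta> (cusp_of x y)"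
    unfolding Gamma1_orbit_def by auto
  have det: "\<alpha> * \<delta> - \<beta> * \<gamma> = 1" and N: "int N dvd \<gamma>" "[\<alpha> = 1] (mod int N)"
    using G by (simp_all add: Gamma1_def cong_0_iff)
  have nz: "x \<noteq> 0 \<or> y \<noteq> 0" "a \<noteq> 0 \<or> c \<noteq> 0" using xy(1) ac by auto
  define a' c' where "a' = \<alpha> * x + \<beta> * y" and "c' = \<gamma> * x + \<delta> * y"
  have "x = (\<alpha> * \<delta> - \<beta> * \<gamma>) * x" "y = (\<alpha> * \<delta> - \<beta> * \<gamma>) * y" unfolding det by simp_all
  then have "x = \<delta> * a' - \<beta> * c'" "y = \<alpha> * c' - \<gamma> * a'"
    unfolding a'_def c'_def by (simp_all add: algebra_simps)
  then have "coprime a' c'" using xy(1)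
    by (metis coprimeI coprime_common_divisor dvd_diff dvd_mult)
  moreover have "a * c' = a' * c"
    using eq cusp_of_eq_iff[OF nz(2) moebius_vector_nonzero[OF det nz(1)]]
    unfolding moebius_cusp_of[OF det nz(1)] a'_def c'_def by simp
  ultimately have abs: "\<bar>a\<bar> = \<bar>a'\<bar>" "\<bar>c\<bar> = \<bar>c'\<bar>" using coprime_int_proportional[OF ac] by blast+
  have "int N dvd c'" unfolding c'_def using N xy(2) by (intro dvd_add dvd_mult2 dvd_mult) auto
  then have "int N dvd c" using abs(2) by (metis dvd_abs_iff)
  moreover have "[a' = 1 * x + \<beta> * 0] (mod int N)"
    unfolding a'_def using N xy(2) by (intro cong_add cong_mult cong_refl) (auto simp: cong_0_iff)
  then have "[a' = x] (mod int N)" by simp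
  then have "[a = x] (mod int N) \<or> [a = - x] (mod int N)"
    using abs(1) by (auto simp: abs_eq_iff cong_minus_minus_iff)
  ultimately show "int N dvd c \<and> ([a = x] (mod int N) \<or> [a = - x] (mod int N))" by blast
next
  have main: "cusp_of a c \<in> Gamma1_orbit N (cusp_of x y)"
    if ac: "coprime a c" and c: "int N dvd c" and ax: "[a = x] (mod int N)" for a c
  proof -
    obtain u v where "u * x + v * y = 1" using bezout_int[of x y] xy(1) by auto
    then have uv: "x * u + v * y = 1" by (simp add: mult.commute)
    obtain b d where "b * a + d * c = 1" using bezout_int[of a c] ac by auto
    then have bd: "a * b + d * c = 1" by (simp add: mult.commute)
    have nz: "x \<noteq> 0 \<or> y \<noteq> 0" using xy(1) by auto
    \<comment> \<open>The matrix with rows (a, -d), (c, b) times the inverse of the one with rows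
      (x, -v), (y, u): it carries the vector (x, y) to (a, c).\<close>
    define A B C D where "A = a * u + d * y" and "B = a * v - d * x" and "C = c * u - b * y" and "D = c * v + b * x"
    have "A * D - B * C = (a * b + d * c) * (x * u + v * y)"
      by (simp add: A_def B_def C_def D_def algebra_simps)
    then have det: "A * D - B * C = 1" by (simp add: uv bd)
    have "A * x + B * y = a * (x * u + v * y)" "C * x + D * y = c * (x * u + v * y)"
      by (simp_all add: A_def B_def C_def D_def algebra_simps)
    then have "cusp_of a c = moebius A B C D (cusp_of x y)"
      unfolding moebius_cusp_of[OF det nz] by (simp add: uv)
    moreover have "Gamma1 N A B C D"
      unfolding Gamma1_def
    proof (intro conjI det)
      show "[C = 0] (mod int N)" unfolding C_def cong_0_iff using c xy(2) by (intro dvd_diff dvd_mult2 dvd_mult) auto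
      have y0: "[y = 0] (mod int N)" and c0: "[c = 0] (mod int N)" using c xy(2) by (simp_all add: cong_0_iff)
      have "[A = x * u + d * 0] (mod int N)" unfolding A_def
        by (intro cong_add cong_mult cong_refl ax y0)
      moreover have "[x * u + v * y = x * u + v * 0] (mod int N)"
        by (intro cong_add cong_mult cong_refl y0)
      ultimately show "[A = 1] (mod int N)" unfolding uv by (simp add: cong_def)
      have "[a * b + d * c = x * b + d * 0] (mod int N)"
        by (intro cong_add cong_mult cong_refl ax c0)
      moreover have "[D = 0 * v + b * x] (mod int N)" unfolding D_def
        by (intro cong_add cong_mult cong_refl c0)
      ultimately show "[D = 1] (mod int N)" unfolding bd by (simp add: cong_def mult.commute)
    qed
    ultimately show ?thesis unfolding Gamma1_orbit_def by auto
  qed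
  assume "int N dvd c \<and> ([a = x] (mod int N) \<or> [a = - x] (mod int N))"
  then show "cusp_of a c \<in> Gamma1_orbit N (cusp_of x y)"
    using main[OF ac] main[of "- a" "- c"] ac
    by (auto simp: cusp_of_uminus cong_minus_minus_iff[of a "- x", symmetric] simp del: cong_minus_minus_iff)
qed

lemma phi5_cusp_of:
  assumes "coprime a c"
  shows "phi5 (cusp_of a c) = (if c mod 5 \<noteq> 0 then 0 else if a mod 5 = 1 \<or> a mod 5 = 4 then 2
    else if a mod 5 = 2 \<or> a mod 5 = 3 then 3 else 0)"
proof -
  have e: "Inf = cusp_of 1 0" "Fin (2 / 5) = cusp_of 2 5" by (simp_all add: cusp_of_def)
  have "coprime (1::int) 0" "coprime (2::int) 5" by simp_all
  then show ?thesis
    unfolding phi5_def e using Gamma1_orbit_iff[of 1 0 5 a c] Gamma1_orbit_iff[of 2 5 5 a c] assms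
    by (auto simp: cong_def dvd_eq_mod_eq_0)
qed

lemma phi7_cusp_of:
  assumes "coprime a c"
  shows "phi7 (cusp_of a c) = (if c mod 7 \<noteq> 0 then 0 else if a mod 7 = 1 \<or> a mod 7 = 6 then 2
    else if a mod 7 = 2 \<or> a mod 7 = 5 then 1 else if a mod 7 = 3 \<or> a mod 7 = 4 then 4 else 0)"
proof -
  have e: "Inf = cusp_of 1 0" "Fin (2 / 7) = cusp_of 2 7" "Fin (3 / 7) = cusp_of 3 7"
    by (simp_all add: cusp_of_def)
  have "coprime (1::int) 0" "coprime (2::int) 7" "coprime (3::int) 7"
    by (simp_all add: coprime_iff_gcd_eq_1 gcd_non_0_int)
  then show ?thesis
    unfolding phi7_def e using Gamma1_orbit_iff[of 1 0 7 a c] Gamma1_orbit_iff[of 2 7 7 a c]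
      Gamma1_orbit_iff[of 3 7 7 a c] assms
    by (auto simp: cong_def dvd_eq_mod_eq_0)
qed

section \<open>The period polynomial modulo 5 and 7\<close>

lemma period_poly_mod:
  fixes c d :: int
  shows "period_poly c d mod p = period_poly (c mod p) (d mod p) mod p"
proof -
  have "[c mod p = c] (mod p)" "[d mod p = d] (mod p)" by simp_all
  then have "[period_poly (c mod p) (d mod p) = period_poly c d] (mod p)"
    unfolding period_poly_def by (intro cong_add cong_diff cong_mult cong_pow cong_refl)
  then show ?thesis by (simp add: cong_def)
qed

lemma mod_5_cases:
  fixes x :: int obtains "x mod 5 = 0" | "x mod 5 = 1" | "x mod 5 = 2" | "x mod 5 = 3" | "x mod 5 = 4"
proof -
  have "x mod 5 = 0 \<or> x mod 5 = 1 \<or> x mod 5 = 2 \<or> x mod 5 = 3 \<or> x mod 5 = 4" by presburger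
  then show ?thesis by (elim disjE) (erule that)+
qed

lemma mod_7_cases:
  fixes x :: int
  obtains "x mod 7 = 0" | "x mod 7 = 1" | "x mod 7 = 2" | "x mod 7 = 3" | "x mod 7 = 4" | "x mod 7 = 5" | "x mod 7 = 6"
proof -
  have "x mod 7 = 0 \<or> x mod 7 = 1 \<or> x mod 7 = 2 \<or> x mod 7 = 3 \<or> x mod 7 = 4 \<or> x mod 7 = 5 \<or> x mod 7 = 6" by presburger
  then show ?thesis by (elim disjE) (erule that)+
qed

lemma det_coprime:
  fixes a b c d :: int
  assumes "a * d - b * c = 1"
  shows "coprime a c" "coprime b d"
proof -
  have "k dvd 1" if "k dvd a" "k dvd c" for k
    using dvd_diff[OF dvd_mult2[OF that(1), of d] dvd_mult[OF that(2), of b]] assms by simp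
  then show "coprime a c" by (intro coprimeI) simp
  have "k dvd 1" if "k dvd b" "k dvd d" for k
    using dvd_diff[OF dvd_mult[OF that(2), of a] dvd_mult2[OF that(1), of c]] assms by simp
  then show "coprime b d" by (intro coprimeI) simp
qed

text \<open>For units c, d modulo 5, Fermat turns X^10 - Y^10 into c^2 - d^2 and the bracket after
  691 into 4 (d^2 - c^2). As 36 = 691 = 1, the sum is 5 (c^2 - d^2) = 0. Otherwise exactly one of c,
  d is divisible by 5. The factor 2 is read off at (0, 1), where -36 = 2 * 2.\<close>

lemma period_poly_phi5:
  assumes det: "a * d - b * c = 1"
  shows "[period_poly c d = 2 * (phi5 (cusp_of a c) - phi5 (cusp_of b d))] (mod 5)"
proof -
  have "[(a mod 5) * (d mod 5) - (b mod 5) * (c mod 5) = a * d - b * c] (mod 5)"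
    by (intro cong_diff cong_mult) simp_all
  then have "((a mod 5) * (d mod 5) - (b mod 5) * (c mod 5)) mod 5 = 1"
    unfolding det by (simp add: cong_def)
  note h = this
  note e = cong_def phi5_cusp_of[OF det_coprime(1)[OF det]] phi5_cusp_of[OF det_coprime(2)[OF det]]
    period_poly_mod[of c d 5]
  consider "c mod 5 = 0" | "c mod 5 \<noteq> 0" "d mod 5 = 0" | "c mod 5 \<noteq> 0" "d mod 5 \<noteq> 0" by blast
  then show ?thesis
  proof cases
    case 1
    then have "((a mod 5) * (d mod 5)) mod 5 = 1" using h by simp
    then show ?thesis unfolding e
      by - (rule mod_5_cases[of d]; rule mod_5_cases[of a]; simp add: period_poly_def 1)
  next
    case 2
    then have "(- ((b mod 5) * (c mod 5))) mod 5 = 1" using h by simp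
    then show ?thesis unfolding e
      by - (rule mod_5_cases[of c]; rule mod_5_cases[of b]; simp add: period_poly_def 2)
  next
    case 3
    then show ?thesis unfolding e
      by - (rule mod_5_cases[of c]; rule mod_5_cases[of d]; simp add: period_poly_def)
  qed
qed

text \<open>For units c, d modulo 7 the two parts become c^4 - d^4 and 3 (c^4 - d^4), and 36 - 3 *
  691 = 1 - 15 = 0. The factor 3 is read off at (0, 1), where -36 = 3 * 2.\<close>

lemma period_poly_phi7:
  assumes det: "a * d - b * c = 1"
  shows "[period_poly c d = 3 * (phi7 (cusp_of a c) - phi7 (cusp_of b d))] (mod 7)"
proof -
  have "[(a mod 7) * (d mod 7) - (b mod 7) * (c mod 7) = a * d - b * c] (mod 7)"
    by (intro cong_diff cong_mult) simp_all
  then have "((a mod 7) * (d mod 7) - (b mod 7) * (c mod 7)) mod 7 = 1"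
    unfolding det by (simp add: cong_def)
  note h = this
  note e = cong_def phi7_cusp_of[OF det_coprime(1)[OF det]] phi7_cusp_of[OF det_coprime(2)[OF det]]
    period_poly_mod[of c d 7]
  consider "c mod 7 = 0" | "c mod 7 \<noteq> 0" "d mod 7 = 0" | "c mod 7 \<noteq> 0" "d mod 7 \<noteq> 0" by blast
  then show ?thesis
  proof cases
    case 1
    then have "((a mod 7) * (d mod 7)) mod 7 = 1" using h by simp
    then show ?thesis unfolding e
      by - (rule mod_7_cases[of d]; rule mod_7_cases[of a]; simp add: period_poly_def 1)
  next
    case 2
    then have "(- ((b mod 7) * (c mod 7))) mod 7 = 1" using h by simp
    then show ?thesis unfolding e
      by - (rule mod_7_cases[of c]; rule mod_7_cases[of b]; simp add: period_poly_def 2)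
  next
    case 3
    then show ?thesis unfolding e
      by - (rule mod_7_cases[of c]; rule mod_7_cases[of d]; simp add: period_poly_def)
  qed
qed

section \<open>Integrality at p and comparison with the period\<close>

lemma Zloc_quotient:
  assumes "b \<noteq> 0" "\<not> int p dvd b"
  shows "of_int a / of_int b \<in> Zloc p"
proof -
  obtain m n where mn: "quotient_of (of_int a / of_int b) = (m, n)" by (cases "quotient_of (of_int a / of_int b)")
  have n: "n > 0" "coprime m n" "of_int a / of_int b = (of_int m / of_int n :: rat)"
    using quotient_of_denom_pos[OF mn] quotient_of_coprime[OF mn] quotient_of_div[OF mn] by auto
  have "(of_int (a * n) :: rat) = of_int (m * b)" using n assms(1) by (simp add: field_simps)
  then have "a * n = m * b" unfolding of_int_eq_iff .
  then have "n dvd m * b" by (metis dvd_triv_right)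
  then have "n dvd b" using n(2) by (metis coprime_commute coprime_dvd_mult_right_iff)
  then have "\<not> int p dvd n" using assms(2) dvd_trans by blast
  moreover have "(of_int a / of_int b :: complex) = of_rat (of_int a / of_int b)" by (simp add: of_rat_divide)
  ultimately show ?thesis unfolding Zloc_def using mn by auto
qed

lemma Zloc_obtain:
  assumes "z \<in> Zloc p"
  obtains a b where "b \<noteq> 0" "\<not> int p dvd b" "z = of_int a / of_int b"
proof -
  obtain q where q: "z = of_rat q" "\<not> int p dvd snd (quotient_of q)" using assms unfolding Zloc_def by auto
  obtain m n where mn: "quotient_of q = (m, n)" by (cases "quotient_of q")
  show ?thesis
    using q quotient_of_div[OF mn] quotient_of_denom_pos[OF mn] mn
    by (intro that[of n m]) (auto simp: of_rat_divide)
qed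

definition int_coeffs :: "complex poly \<Rightarrow> bool" where
  "int_coeffs p \<longleftrightarrow> (\<forall>i. coeff p i \<in> \<int>)"

lemma int_coeffs_intros:
  "int_coeffs 0" "int_coeffs 1" "int_coeffs (numeral k)" "int_coeffs [:of_int a, of_int b:]"
  "int_coeffs p \<Longrightarrow> int_coeffs (- p)"
  "int_coeffs p \<Longrightarrow> int_coeffs q \<Longrightarrow> int_coeffs (p + q)"
  "int_coeffs p \<Longrightarrow> int_coeffs q \<Longrightarrow> int_coeffs (p - q)"
  "int_coeffs p \<Longrightarrow> int_coeffs q \<Longrightarrow> int_coeffs (p * q)"
  by (auto simp: int_coeffs_def coeff_mult coeff_pCons coeff_1 numeral_poly split: nat.splits
      intro!: Ints_sum Ints_mult)

lemma int_coeffs_power: "int_coeffs p \<Longrightarrow> int_coeffs (p ^ n)"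
  by (induction n) (auto intro: int_coeffs_intros)

text \<open>The period condition concerns every coefficient, not only the value at (0, 1).
  Translates of \<open>period_poly\<close> by integer matrices keep integer coefficients, and sums
  along Manin's chains preserve this. Setting Y = 1 loses nothing for forms of fixed degree.\<close>

lemma msym_plus_integral:
  assumes "j \<le> 10"
  shows "\<exists>n. msym_plus j r s = msym_plus 10 Inf (Fin 0) / 36 * of_int n"
proof -
  define l where "l = msym_plus 10 Inf (Fin 0) / 36"
  have "\<exists>f. int_coeffs f \<and> (\<forall>x. plusP x 1 r s = l * poly f x)"
  proof (induction r s rule: cusp_induct)
    case (1 r) show ?case by (intro exI[of _ 0]) (simp add: plusP_refl int_coeffs_intros)
  next
    case (2 r s)
    then obtain f where "int_coeffs f" "\<And>x. plusP x 1 r s = l * poly f x" by blast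
    then show ?case by (intro exI[of _ "- f"]) (simp add: plusP_swap[of _ _ s r] int_coeffs_intros)
  next
    case (3 r s t)
    then obtain f g where "int_coeffs f" "\<And>x. plusP x 1 r s = l * poly f x"
      "int_coeffs g" "\<And>x. plusP x 1 s t = l * poly g x" by blast
    then show ?case
      by (intro exI[of _ "f + g"]) (simp add: plusP_add[symmetric, of _ _ r t s] ring_distribs int_coeffs_intros)
  next
    case (4 a b c d)
    define f where "f = period_poly [:of_int c, of_int a:] [:of_int d, of_int b :: complex:]"
    have "int_coeffs f" unfolding f_def period_poly_def by (intro int_coeffs_intros int_coeffs_power)
    moreover have "plusP x 1 (cusp_of a c) (cusp_of b d) = l * poly f x" for x
      unfolding plusP_cusp_of[OF 4] plusP_period_poly l_def[symmetric] f_def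
      by (simp add: period_poly_def poly_power add.commute mult.commute)
    ultimately show ?case by blast
  qed
  then obtain f where f: "int_coeffs f" "\<And>x. plusP x 1 r s = l * poly f x" by blast
  \<comment> \<open>Polynomials agreeing at every complex x have equal coefficients, which turns the
    identity of values into integrality of each coefficient.\<close>
  define g where "g = (\<Sum>j\<le>10. monom (msym_plus j r s) j)"
  have "poly g x = poly (smult l f) x" for x
    using f(2)[of x] by (simp add: g_def poly_sum poly_monom plusP_def)
  then have "g = smult l f" by (simp add: poly_eq_poly_eq_iff[symmetric] fun_eq_iff)
  then have "coeff g j = l * coeff f j" by simp
  moreover have "coeff g j = msym_plus j r s" using assms by (simp add: g_def coeff_sum)
  moreover obtain n where "coeff f j = of_int n" using f(1) unfolding int_coeffs_def by (metis Ints_cases)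
  ultimately show ?thesis unfolding l_def by auto
qed

text \<open>The integer n is carried as a witness through the chain: the symbol value determines it
  only once the scalar in front is known to be nonzero.\<close>

lemma msym_plus_0_cong:
  assumes base: "\<And>a b c d. a * d - b * c = 1 \<Longrightarrow>
    [period_poly c d = c0 * (\<phi> (cusp_of a c) - \<phi> (cusp_of b d))] (mod p)"
  shows "\<exists>n. msym_plus 0 r s = msym_plus 10 Inf (Fin 0) / 36 * of_int n \<and> [n = c0 * (\<phi> r - \<phi> s)] (mod p)"
  unfolding plusP_0_1[symmetric, of r s]
proof (induction r s rule: cusp_induct)
  case (1 r) show ?case by (intro exI[of _ 0]) (simp add: plusP_refl)
next
  case (2 r s)
  then obtain n where n: "plusP 0 1 r s = msym_plus 10 Inf (Fin 0) / 36 * of_int n" "[n = c0 * (\<phi> r - \<phi> s)] (mod p)"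
    by blast
  then have "[- n = - (c0 * (\<phi> r - \<phi> s))] (mod p)" by (simp only: cong_minus_minus_iff)
  moreover have "- (c0 * (\<phi> r - \<phi> s)) = c0 * (\<phi> s - \<phi> r)" by (simp add: algebra_simps)
  ultimately show ?case using n(1) by (intro exI[of _ "- n"]) (simp add: plusP_swap[of _ _ s r])
next
  case (3 r s t)
  then obtain n n' where n: "plusP 0 1 r s = msym_plus 10 Inf (Fin 0) / 36 * of_int n" "[n = c0 * (\<phi> r - \<phi> s)] (mod p)"
    and n': "plusP 0 1 s t = msym_plus 10 Inf (Fin 0) / 36 * of_int n'" "[n' = c0 * (\<phi> s - \<phi> t)] (mod p)"
    by blast
  have "c0 * (\<phi> r - \<phi> s) + c0 * (\<phi> s - \<phi> t) = c0 * (\<phi> r - \<phi> t)" by (simp add: algebra_simps)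
  then have "[n + n' = c0 * (\<phi> r - \<phi> t)] (mod p)" using cong_add[OF n(2) n'(2)] by simp
  moreover have "plusP 0 1 r t = msym_plus 10 Inf (Fin 0) / 36 * of_int (n + n')"
    unfolding plusP_add[symmetric, of 0 1 r t s] n(1) n'(1) by (simp add: distrib_left)
  ultimately show ?case by blast
next
  case (4 a b c d)
  have "plusP 0 1 (cusp_of a c) (cusp_of b d) = msym_plus 10 Inf (Fin 0) / 36 * of_int (period_poly c d)"
    unfolding plusP_cusp_of[OF 4] plusP_period_poly by (simp add: period_poly_def)
  then show ?case using base[OF 4] by blast
qed

theorem theorem3p5:
  fixes p :: nat and \<Omega> :: complex
  assumes "p \<in> {5, 7}"
    and "coh_period p \<Omega>"
  shows "\<exists>c::int. \<not> int p dvd c \<and>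
           (\<forall>r s q. msym_plus 0 r s / \<Omega> = of_rat q \<longrightarrow>
              [fst (quotient_of q) = c * (phi_p p r - phi_p p s) * snd (quotient_of q)] (mod int p))"
proof -
  have p: "prime (int p)" "\<not> int p dvd 36" using assms(1) by auto
  define l where "l = msym_plus 10 Inf (Fin 0) / 36"
  have \<Omega>: "\<Omega> \<noteq> 0"
    and int: "\<And>r s j. j \<le> 10 \<Longrightarrow> msym_plus j r s / \<Omega> \<in> Zloc p"
    and nint: "\<exists>r s. \<exists>j\<le>10. msym_plus j r s / (\<Omega> * of_nat p) \<notin> Zloc p"
    using assms(2) unfolding coh_period_def by auto
  \<comment> \<open>On the base path the coefficient of X^10 is 36 l, so p-integrality of the
    normalised symbol writes l / \<Omega> with denominator 36 y, prime to p.\<close>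
  obtain x y where xy: "y \<noteq> 0" "\<not> int p dvd y" "36 * (l / \<Omega>) = of_int x / of_int y"
    using Zloc_obtain[OF int[of 10 Inf "Fin 0"]] unfolding l_def
    by (metis order_refl times_divide_eq_right nonzero_mult_div_cancel_left divide_divide_eq_left zero_neq_numeral mult.commute)
  define z where "z = 36 * y"
  have z: "z \<noteq> 0" "\<not> int p dvd z"
    using xy p prime_dvd_mult_iff[of "int p" 36 y] by (auto simp: z_def)
  have l: "l / \<Omega> = of_int x / of_int z" using xy(1,3) by (simp add: z_def field_simps)
  \<comment> \<open>If p divided x, all coefficients, being integer multiples of l, would stay
    p-integral after one more division by p, against the choice of period.\<close>
  have px: "\<not> int p dvd x"
  proof
    assume "int p dvd x"
    then obtain x' where x': "x = int p * x'" by (elim dvdE)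
    have "msym_plus j r s / (\<Omega> * of_nat p) \<in> Zloc p" if j: "j \<le> 10" for j r s
    proof -
      obtain n where "msym_plus j r s = l * of_int n" using msym_plus_integral[OF j] unfolding l_def by blast
      then have "msym_plus j r s / (\<Omega> * of_nat p) = (l / \<Omega>) * of_int n / of_nat p" by simp
      also have "\<dots> = of_int (x' * n) / of_int z" unfolding l x' using p(1) by auto
      finally show ?thesis by (simp only: Zloc_quotient[OF z])
    qed
    then show False using nint by blast
  qed
  obtain c0 where c0: "\<not> int p dvd c0" "\<And>a b c d. a * d - b * c = 1 \<Longrightarrow>
      [period_poly c d = c0 * (phi_p p (cusp_of a c) - phi_p p (cusp_of b d))] (mod int p)"
  proof (cases "p = 5")
    case True
    then show ?thesis using period_poly_phi5 that[of 2] by (simp add: phi_p_def)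
  next
    case False
    then have "p = 7" using assms(1) by simp
    then show ?thesis using period_poly_phi7 that[of 3] by (simp add: phi_p_def)
  qed
  have "coprime z (int p)" using prime_imp_coprime[OF p(1) z(2)] by (simp only: coprime_commute)
  then obtain w where w: "[z * w = 1] (mod int p)" using cong_solve_coprime_int by blast
  have pw: "\<not> int p dvd w"
  proof
    assume "int p dvd w"
    then have "[z * w = 0] (mod int p)" by (simp add: cong_0_iff)
    then have "[1 = 0] (mod int p)" using w cong_sym cong_trans by blast
    then show False using p(1) by (simp add: cong_0_iff)
  qed
  show ?thesis
  \<comment> \<open>Here x w represents l / \<Omega> modulo p, and c0 compares
    \<open>period_poly\<close> with \<open>phi_p\<close>.\<close>
  proof (intro exI[of _ "x * w * c0"] conjI allI impI)
    show "\<not> int p dvd x * w * c0" using p(1) px pw c0(1) by (simp add: prime_dvd_mult_iff)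
    fix r s q assume q: "msym_plus 0 r s / \<Omega> = of_rat q"
    obtain m d where md: "quotient_of q = (m, d)" by (cases "quotient_of q")
    have d: "d > 0" "q = of_int m / of_int d" using quotient_of_denom_pos[OF md] quotient_of_div[OF md] by auto
    obtain n where n: "msym_plus 0 r s = l * of_int n" "[n = c0 * (phi_p p r - phi_p p s)] (mod int p)"
      using msym_plus_0_cong[OF c0(2)] unfolding l_def by blast
    have "of_int m / of_int d = (l / \<Omega>) * of_int n" using q n(1) d by (simp add: of_rat_divide)
    then have "(of_int (m * z) :: complex) = of_int (x * n * d)"
      unfolding l using d z by (simp add: field_simps)
    then have mz: "m * z = x * n * d" unfolding of_int_eq_iff .
    have "[m * 1 = m * (z * w)] (mod int p)" by (intro cong_mult cong_refl cong_sym[OF w])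
    also have "m * (z * w) = x * w * n * d" using mz by (metis (no_types, opaque_lifting) mult.assoc mult.commute)
    also have "[x * w * n * d = x * w * (c0 * (phi_p p r - phi_p p s)) * d] (mod int p)"
      by (intro cong_mult cong_refl n)
    finally show "[fst (quotient_of q) = x * w * c0 * (phi_p p r - phi_p p s) * snd (quotient_of q)] (mod int p)"
      by (simp add: md mult.assoc)
  qed
qed

end
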